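(* For pointed morphisms $F,G\colon\mathscr{D}\to\mathscr{E}$ of pointed derivators and a natural transformation $\alpha\colon F\to G$ the square $$\begin{array}{ccc}\Sigma\circ F&\xrightarrow{\ \psi_F\ }&F\circ\Sigma\\ {\scriptstyle\Sigma\alpha}\downarrow&&\downarrow{\scriptstyle\alpha\Sigma}\\ \Sigma\circ G&\xrightarrow{\ \psi_G\ }&G\circ\Sigma\end{array}$$ of functors $\mathscr{D}(\mathbb{1})\to\mathscr{E}(\mathbb{1})$ commutes, where $\psi_F,\psi_G$ are the canonical comparison maps.
   Context: **Derivators.** $\mathbf{Cat}$ is the 2-category of small categories, $\mathbf{CAT}$ that of not necessarily small categories, $\mathbb{1}$ is the terminal category, $\pi_A\colon A\to\mathbb{1}$ the unique functor; objects $a\in A$ are identified with functors $a\colon\mathbb{1}\to A$. A prederivator is a strict 2-functor $\mathscr{D}\colon\mathbf{Cat}^{\mathrm{op}}\to\mathbf{CAT}$ (op reverses functors only); $u\colon A\to B$ induces $u^\ast\colon\mathscr{D}(B)\to\mathscr{D}(A)$, and $X_a:=a^\ast X$. It is a derivator if: (Der1) $\mathscr{D}$ sends coproducts to products; (Der2) $f$ in $\mathscr{D}(A)$ is an isomorphism iff $f_a$ is so for all $a\in A$; (Der3) each $u^\ast$ has a left adjoint $u_!$ and a right adjoint $u_\ast$ (write $\operatorname{colim}_A=(\pi_A)_!$, $\lim_A=(\pi_A)_\ast$); (Der4) for $u\colon A\to B$, $b\in B$, with projections $p\colon(u/b)\to A$, $q\colon(b/u)\to A$ from the slice categories, the canonical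 mates $\operatorname{colim}_{(u/b)}p^\ast\to b^\ast u_!$ and $b^\ast u_\ast\to\lim_{(b/u)}q^\ast$ are isomorphisms. A derivator is pointed if $\mathscr{D}(\mathbb{1})$ has a zero object. **Morphisms.** A morphism $F\colon\mathscr{D}\to\mathscr{E}$ is a pseudo-natural transformation: functors $F_A\colon\mathscr{D}(A)\to\mathscr{E}(A)$ and coherent natural isomorphisms $\gamma_u\colon u^\ast F_B\cong F_Au^\ast$ for $u\colon A\to B$. A natural transformation $\alpha\colon F\to G$ is a modification: natural transformations $\alpha_A\colon F_A\to G_A$ compatible with the $\gamma_u$. There are canonical mates $$u_!F_A\xrightarrow{\eta}u_!F_Au^\ast u_!\xrightarrow{\gamma_u^{-1}}u_!u^\ast F_Bu_!\xrightarrow{\varepsilon}F_Bu_!,\qquad F_Bu_\ast\xrightarrow{\eta}u_\ast u^\ast F_Bu_\ast\xrightarrow{\gamma_u}u_\ast F_Au^\ast u_\ast\xrightarrow{\varepsilon}u_\ast F_A,$$ and $F$ preserves left (right) Kan extensions along $u$ if the first (second) is an isomorphism. A morphism of pointed derivators is pointed if it preserves zero objects (i.e., left Kan extensions along $\emptyset\to\mathbb{1}$, equivalently right Kan extensions along $\emptyset\to\mathbb{1}$); a pointed morphism preserves right Kan extensions along sieves (fully faithful functors $u\colon A\to B$, injective on objects, such that any $b$ admitting a map $b\to u(a)$ is in the image). **Suspension and comparison map.** Let $\square=[1]\times[1]$, let $i_\ulcorner\colon\ulcorner\to\square$ be the full subcategory omitting $(1,1)$, and let $i=(0,0)\colon\mathbb{1}\to\ulcorner$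 (a sieve). The suspension functor of a pointed derivator is $\Sigma=(1,1)^\ast(i_\ulcorner)_!\,i_\ast\colon\mathscr{D}(\mathbb{1})\to\mathscr{D}(\mathbb{1})$. For pointed $F$ the canonical comparison map $\psi_F\colon\Sigma F_{\mathbb{1}}\to F_{\mathbb{1}}\Sigma$ is the composite $$(1,1)^\ast(i_\ulcorner)_!\,i_\ast F_{\mathbb{1}}\xrightarrow{\cong}(1,1)^\ast(i_\ulcorner)_!F_\ulcorner i_\ast\to(1,1)^\ast F_\square(i_\ulcorner)_!\,i_\ast\xrightarrow{\cong}F_{\mathbb{1}}(1,1)^\ast(i_\ulcorner)_!\,i_\ast,$$ where the first map is the inverse of the mate $F_\ulcorner i_\ast\to i_\ast F_{\mathbb{1}}$, the second is the mate $(i_\ulcorner)_!F_\ulcorner\to F_\square(i_\ulcorner)_!$, and the third is $\gamma_{(1,1)}$. In the square, $F$, $G$, $\alpha$ stand for $F_{\mathbb{1}}$, $G_{\mathbb{1}}$, $\alpha_{\mathbb{1}}$. *)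

theory Defs
  imports Main "HOL-Library.FuncSet"
begin

section \<open>Categories, functors, natural transformations\<close>

text \<open>
  A category is a record of carriers and structure maps. All structure maps of categories, functors
  and natural transformations are required to be \<open>undefined\<close> outside their carriers, so
  that equality of records is equality of categories, of functors and of transformations.
\<close>

record ('o, 'm) cat =
  Obj :: "'o set"
  Arr :: "'m set"
  Dom :: "'m \<Rightarrow> 'o"
  Cod :: "'m \<Rightarrow> 'o"
  Idn :: "'o \<Rightarrow> 'm"
  Comp :: "'m \<Rightarrow> 'm \<Rightarrow> 'm"  \<comment> \<open>\<open>Comp g f\<close> is g after f\<close>

definition in_hom :: "('o, 'm) cat \<Rightarrow> 'm \<Rightarrow> 'o \<Rightarrow> 'o \<Rightarrow> bool" where
  "in_hom C f a b \<longleftrightarrow> f \<in> Arr C \<and> Dom C f = a \<and> Cod C f = b"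

definition category :: "('o, 'm) cat \<Rightarrow> bool" where
  "category C \<longleftrightarrow>
     Dom C \<in> Arr C \<rightarrow>\<^sub>E Obj C \<and>
     Cod C \<in> Arr C \<rightarrow>\<^sub>E Obj C \<and>
     Idn C \<in> Obj C \<rightarrow>\<^sub>E Arr C \<and>
     (\<forall>a\<in>Obj C. in_hom C (Idn C a) a a) \<and>
     (\<forall>f g a b c. in_hom C f a b \<and> in_hom C g b c \<longrightarrow> in_hom C (Comp C g f) a c) \<and>
     (\<forall>f g. \<not> (f \<in> Arr C \<and> g \<in> Arr C \<and> Cod C f = Dom C g) \<longrightarrow> Comp C g f = undefined) \<and>
     (\<forall>f a b. in_hom C f a b \<longrightarrow> Comp C f (Idn C a) = f \<and> Comp C (Idn C b) f = f) \<and>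
     (\<forall>f g h a b c d. in_hom C f a b \<and> in_hom C g b c \<and> in_hom C h c d \<longrightarrow>
        Comp C h (Comp C g f) = Comp C (Comp C h g) f)"

definition mk_cat :: "'o set \<Rightarrow> 'm set \<Rightarrow> ('m \<Rightarrow> 'o) \<Rightarrow> ('m \<Rightarrow> 'o) \<Rightarrow> ('o \<Rightarrow> 'm)
    \<Rightarrow> ('m \<Rightarrow> 'm \<Rightarrow> 'm) \<Rightarrow> ('o, 'm) cat" where
  "mk_cat Ob Ar d c i m = \<lparr> Obj = Ob, Arr = Ar,
     Dom = restrict d Ar, Cod = restrict c Ar, Idn = restrict i Ob,
     Comp = (\<lambda>g f. if f \<in> Ar \<and> g \<in> Ar \<and> c f = d g then m g f else undefined) \<rparr>"

definition inverse_arr :: "('o, 'm) cat \<Rightarrow> 'm \<Rightarrow> 'm \<Rightarrow> bool" where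
  "inverse_arr C f g \<longleftrightarrow> f \<in> Arr C \<and> in_hom C g (Cod C f) (Dom C f) \<and>
     Comp C g f = Idn C (Dom C f) \<and> Comp C f g = Idn C (Cod C f)"

definition iso_arr :: "('o, 'm) cat \<Rightarrow> 'm \<Rightarrow> bool" where
  "iso_arr C f \<longleftrightarrow> (\<exists>g. inverse_arr C f g)"

definition inv_arr :: "('o, 'm) cat \<Rightarrow> 'm \<Rightarrow> 'm" where
  "inv_arr C f = (THE g. inverse_arr C f g)"

definition zero_object :: "('o, 'm) cat \<Rightarrow> 'o \<Rightarrow> bool" where
  "zero_object C z \<longleftrightarrow> z \<in> Obj C \<and>
     (\<forall>x\<in>Obj C. (\<exists>!f. in_hom C f z x) \<and> (\<exists>!f. in_hom C f x z))"

record ('o1, 'm1, 'o2, 'm2) ftor =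
  Src :: "('o1, 'm1) cat"
  Tgt :: "('o2, 'm2) cat"
  Om :: "'o1 \<Rightarrow> 'o2"
  Am :: "'m1 \<Rightarrow> 'm2"

definition mk_ftor :: "('o1, 'm1) cat \<Rightarrow> ('o2, 'm2) cat \<Rightarrow> ('o1 \<Rightarrow> 'o2) \<Rightarrow> ('m1 \<Rightarrow> 'm2)
    \<Rightarrow> ('o1, 'm1, 'o2, 'm2) ftor" where
  "mk_ftor A B f g = \<lparr> Src = A, Tgt = B, Om = restrict f (Obj A), Am = restrict g (Arr A) \<rparr>"

definition is_ftor :: "('o1, 'm1, 'o2, 'm2) ftor \<Rightarrow> ('o1, 'm1) cat \<Rightarrow> ('o2, 'm2) cat \<Rightarrow> bool" where
  "is_ftor F A B \<longleftrightarrow> category A \<and> category B \<and> Src F = A \<and> Tgt F = B \<and>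
     Om F \<in> Obj A \<rightarrow>\<^sub>E Obj B \<and>
     Am F \<in> Arr A \<rightarrow>\<^sub>E Arr B \<and>
     (\<forall>f a b. in_hom A f a b \<longrightarrow> in_hom B (Am F f) (Om F a) (Om F b)) \<and>
     (\<forall>a\<in>Obj A. Am F (Idn A a) = Idn B (Om F a)) \<and>
     (\<forall>f g a b c. in_hom A f a b \<and> in_hom A g b c \<longrightarrow>
        Am F (Comp A g f) = Comp B (Am F g) (Am F f))"

definition id_ftor :: "('o, 'm) cat \<Rightarrow> ('o, 'm, 'o, 'm) ftor" where
  "id_ftor A = mk_ftor A A (\<lambda>x. x) (\<lambda>f. f)"

definition comp_ftor :: "('o2, 'm2, 'o3, 'm3) ftor \<Rightarrow> ('o1, 'm1, 'o2, 'm2) ftor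
    \<Rightarrow> ('o1, 'm1, 'o3, 'm3) ftor"  (infixr "\<odot>" 75) where
  "G \<odot> F = mk_ftor (Src F) (Tgt G) (\<lambda>x. Om G (Om F x)) (\<lambda>f. Am G (Am F f))"

record ('o1, 'm1, 'o2, 'm2) ntr =
  NSrc :: "('o1, 'm1, 'o2, 'm2) ftor"
  NTgt :: "('o1, 'm1, 'o2, 'm2) ftor"
  At :: "'o1 \<Rightarrow> 'm2"

definition mk_ntr :: "('o1, 'm1, 'o2, 'm2) ftor \<Rightarrow> ('o1, 'm1, 'o2, 'm2) ftor \<Rightarrow> ('o1 \<Rightarrow> 'm2)
    \<Rightarrow> ('o1, 'm1, 'o2, 'm2) ntr" where
  "mk_ntr F G t = \<lparr> NSrc = F, NTgt = G, At = restrict t (Obj (Src F)) \<rparr>"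

definition is_ntr :: "('o1, 'm1, 'o2, 'm2) ntr \<Rightarrow> ('o1, 'm1, 'o2, 'm2) ftor
    \<Rightarrow> ('o1, 'm1, 'o2, 'm2) ftor \<Rightarrow> bool" where
  "is_ntr t F G \<longleftrightarrow> (\<exists>A B. is_ftor F A B \<and> is_ftor G A B \<and> NSrc t = F \<and> NTgt t = G \<and>
     At t \<in> Obj A \<rightarrow>\<^sub>E Arr B \<and>
     (\<forall>x\<in>Obj A. in_hom B (At t x) (Om F x) (Om G x)) \<and>
     (\<forall>f x y. in_hom A f x y \<longrightarrow> Comp B (At t y) (Am F f) = Comp B (Am G f) (At t x)))"

definition is_nat_iso :: "('o1, 'm1, 'o2, 'm2) ntr \<Rightarrow> ('o1, 'm1, 'o2, 'm2) ftor
    \<Rightarrow> ('o1, 'm1, 'o2, 'm2) ftor \<Rightarrow> bool" where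
  "is_nat_iso t F G \<longleftrightarrow> is_ntr t F G \<and> (\<forall>x\<in>Obj (Src F). iso_arr (Tgt F) (At t x))"

definition id_ntr :: "('o1, 'm1, 'o2, 'm2) ftor \<Rightarrow> ('o1, 'm1, 'o2, 'm2) ntr" where
  "id_ntr F = mk_ntr F F (\<lambda>x. Idn (Tgt F) (Om F x))"

text \<open>\<open>t \<cdot> s\<close> is the vertical composite (first s, then t); \<open>H \<triangleright> t\<close> and
  \<open>t \<triangleleft> K\<close> are the whiskerings by a functor H applied after, resp. K applied before.\<close>

definition vcomp :: "('o1, 'm1, 'o2, 'm2) ntr \<Rightarrow> ('o1, 'm1, 'o2, 'm2) ntr
    \<Rightarrow> ('o1, 'm1, 'o2, 'm2) ntr"  (infixr "\<cdot>" 65) where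
  "t \<cdot> s = mk_ntr (NSrc s) (NTgt t) (\<lambda>x. Comp (Tgt (NSrc s)) (At t x) (At s x))"

definition whisker_after :: "('o2, 'm2, 'o3, 'm3) ftor \<Rightarrow> ('o1, 'm1, 'o2, 'm2) ntr
    \<Rightarrow> ('o1, 'm1, 'o3, 'm3) ntr"  (infixr "\<triangleright>" 70) where
  "H \<triangleright> t = mk_ntr (H \<odot> NSrc t) (H \<odot> NTgt t) (\<lambda>x. Am H (At t x))"

definition whisker_before :: "('o2, 'm2, 'o3, 'm3) ntr \<Rightarrow> ('o1, 'm1, 'o2, 'm2) ftor
    \<Rightarrow> ('o1, 'm1, 'o3, 'm3) ntr"  (infixl "\<triangleleft>" 72) where
  "t \<triangleleft> K = mk_ntr (NSrc t \<odot> K) (NTgt t \<odot> K) (\<lambda>x. At t (Om K x))"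

definition hcomp :: "('o2, 'm2, 'o3, 'm3) ntr \<Rightarrow> ('o1, 'm1, 'o2, 'm2) ntr
    \<Rightarrow> ('o1, 'm1, 'o3, 'm3) ntr"  where
  "hcomp t s = (t \<triangleleft> NTgt s) \<cdot> (NSrc t \<triangleright> s)"

definition inv_ntr :: "('o1, 'm1, 'o2, 'm2) ntr \<Rightarrow> ('o1, 'm1, 'o2, 'm2) ntr" where
  "inv_ntr t = mk_ntr (NTgt t) (NSrc t) (\<lambda>x. inv_arr (Tgt (NSrc t)) (At t x))"

definition equivalence_ftor :: "('o1, 'm1, 'o2, 'm2) ftor \<Rightarrow> ('o1, 'm1) cat \<Rightarrow> ('o2, 'm2) cat
    \<Rightarrow> bool" where
  "equivalence_ftor F A B \<longleftrightarrow> is_ftor F A B \<and>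
     (\<exists>G s t. is_ftor G B A \<and> is_nat_iso s (id_ftor A) (G \<odot> F) \<and> is_nat_iso t (F \<odot> G) (id_ftor B))"

text \<open>Adjunctions \<open>LAdj \<stileturn> RAdj\<close>, with unit and counit as part of the data.\<close>

record ('o1, 'm1, 'o2, 'm2) adj =
  LAdj :: "('o1, 'm1, 'o2, 'm2) ftor"
  RAdj :: "('o2, 'm2, 'o1, 'm1) ftor"
  Unit :: "('o1, 'm1, 'o1, 'm1) ntr"
  Counit :: "('o2, 'm2, 'o2, 'm2) ntr"

definition adjunction :: "('o1, 'm1, 'o2, 'm2) adj \<Rightarrow> bool" where
  "adjunction K \<longleftrightarrow> (\<exists>A B. is_ftor (LAdj K) A B \<and> is_ftor (RAdj K) B A \<and>
     is_ntr (Unit K) (id_ftor A) (RAdj K \<odot> LAdj K) \<and>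
     is_ntr (Counit K) (LAdj K \<odot> RAdj K) (id_ftor B) \<and>
     (Counit K \<triangleleft> LAdj K) \<cdot> (LAdj K \<triangleright> Unit K) = id_ntr (LAdj K) \<and>
     (RAdj K \<triangleright> Counit K) \<cdot> (Unit K \<triangleleft> RAdj K) = id_ntr (RAdj K))"

text \<open>
  Mates. For adjunctions \<open>K : L \<stileturn> U\<close>, \<open>K' : L' \<stileturn> U'\<close> and
  \<open>s : P U \<Rightarrow> U' Q\<close>, the left mate is \<open>L' P \<Rightarrow> L' P U L \<Rightarrow> L' U' Q L \<Rightarrow> Q L\<close>.
  For adjunctions \<open>K : U \<stileturn> R\<close>, \<open>K' : U' \<stileturn> R'\<close> and
  \<open>s : U' Q \<Rightarrow> P U\<close>, the right mate is \<open>Q R \<Rightarrow> R' U' Q R \<Rightarrow> R' P U R \<Rightarrow> R' P\<close>.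
\<close>

definition left_mate :: "('a1, 'b1, 'a2, 'b2) adj \<Rightarrow> ('c1, 'd1, 'c2, 'd2) adj
    \<Rightarrow> ('a1, 'b1, 'c1, 'd1) ftor \<Rightarrow> ('a2, 'b2, 'c2, 'd2) ftor
    \<Rightarrow> ('a2, 'b2, 'c1, 'd1) ntr \<Rightarrow> ('a1, 'b1, 'c2, 'd2) ntr" where
  "left_mate K K' P Q s =
     (Counit K' \<triangleleft> (Q \<odot> LAdj K)) \<cdot> (LAdj K' \<triangleright> (s \<triangleleft> LAdj K)) \<cdot> ((LAdj K' \<odot> P) \<triangleright> Unit K)"

definition right_mate :: "('a2, 'b2, 'a1, 'b1) adj \<Rightarrow> ('c2, 'd2, 'c1, 'd1) adj
    \<Rightarrow> ('a1, 'b1, 'c1, 'd1) ftor \<Rightarrow> ('a2, 'b2, 'c2, 'd2) ftor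
    \<Rightarrow> ('a2, 'b2, 'c1, 'd1) ntr \<Rightarrow> ('a1, 'b1, 'c2, 'd2) ntr" where
  "right_mate K K' P Q s =
     ((RAdj K' \<odot> P) \<triangleright> Counit K) \<cdot> (RAdj K' \<triangleright> (s \<triangleleft> RAdj K)) \<cdot> (Unit K' \<triangleleft> (Q \<odot> RAdj K))"


section \<open>Small categories\<close>

text \<open>
  Objects and arrows of small categories are drawn from one type, built freely over an arbitrary
  type of atoms so that it has two distinguished points and pairs.
\<close>

datatype 'u elt = E0 | E1 | Atm 'u | Pr (pfst: "'u elt") (psnd: "'u elt")

type_synonym 'u scat = "('u elt, 'u elt) cat"
type_synonym 'u sftor = "('u elt, 'u elt, 'u elt, 'u elt) ftor"
type_synonym 'u sntr = "('u elt, 'u elt, 'u elt, 'u elt) ntr"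

text \<open>
  \<open>S X\<close> means that the set X is small. For a Grothendieck universe U containing an infinite set,
  take U for \<open>'u\<close> and the sets equinumerous to an element of U for S; then every U-small
  category is isomorphic to one in the sense of \<open>small_cat\<close>. Closure under power sets is not
  required: it is not needed to form the 2-category of small categories, coproducts and slices.
\<close>

definition smallness :: "('u elt set \<Rightarrow> bool) \<Rightarrow> bool" where
  "smallness S \<longleftrightarrow>
     (\<exists>X. S X \<and> infinite X) \<and>
     (\<forall>X Y. S X \<and> Y \<subseteq> X \<longrightarrow> S Y) \<and>
     (\<forall>X f. S X \<longrightarrow> S (f ` X)) \<and>
     (\<forall>I X. S I \<and> (\<forall>i\<in>I. S (X i)) \<longrightarrow> S (\<Union>i\<in>I. X i))"

definition small_cat :: "('u elt set \<Rightarrow> bool) \<Rightarrow> 'u scat \<Rightarrow> bool" where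
  "small_cat S A \<longleftrightarrow> category A \<and> S (Obj A) \<and> S (Arr A)"

definition small_ftor :: "('u elt set \<Rightarrow> bool) \<Rightarrow> 'u sftor \<Rightarrow> 'u scat \<Rightarrow> 'u scat \<Rightarrow> bool" where
  "small_ftor S u A B \<longleftrightarrow> small_cat S A \<and> small_cat S B \<and> is_ftor u A B"

definition one_cat :: "'u scat" where
  "one_cat = mk_cat {E0} {E0} (\<lambda>_. E0) (\<lambda>_. E0) (\<lambda>_. E0) (\<lambda>_ _. E0)"

definition bang :: "'u scat \<Rightarrow> 'u sftor" where
  "bang A = mk_ftor A one_cat (\<lambda>_. E0) (\<lambda>_. E0)"

definition pt :: "'u scat \<Rightarrow> 'u elt \<Rightarrow> 'u sftor" where
  "pt A a = mk_ftor one_cat A (\<lambda>_. a) (\<lambda>_. Idn A a)"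

text \<open>The poset \<open>[1]\<close>: the arrow from x to y is \<open>Pr x y\<close>.\<close>

definition interval_cat :: "'u scat" where
  "interval_cat = mk_cat {E0, E1} {Pr E0 E0, Pr E0 E1, Pr E1 E1} pfst psnd (\<lambda>x. Pr x x)
     (\<lambda>g f. Pr (pfst f) (psnd g))"

definition prod2_cat :: "'u scat \<Rightarrow> 'u scat \<Rightarrow> 'u scat" where
  "prod2_cat A B = mk_cat {Pr a b |a b. a \<in> Obj A \<and> b \<in> Obj B} {Pr f g |f g. f \<in> Arr A \<and> g \<in> Arr B}
     (\<lambda>f. Pr (Dom A (pfst f)) (Dom B (psnd f)))
     (\<lambda>f. Pr (Cod A (pfst f)) (Cod B (psnd f)))
     (\<lambda>x. Pr (Idn A (pfst x)) (Idn B (psnd x)))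
     (\<lambda>g f. Pr (Comp A (pfst g) (pfst f)) (Comp B (psnd g) (psnd f)))"

definition full_subcat :: "'u scat \<Rightarrow> 'u elt set \<Rightarrow> 'u scat" where
  "full_subcat A X = mk_cat (Obj A \<inter> X) {f \<in> Arr A. Dom A f \<in> X \<and> Cod A f \<in> X}
     (Dom A) (Cod A) (Idn A) (Comp A)"

definition full_incl :: "'u scat \<Rightarrow> 'u elt set \<Rightarrow> 'u sftor" where
  "full_incl A X = mk_ftor (full_subcat A X) A (\<lambda>x. x) (\<lambda>f. f)"

definition coprod_cat :: "'u elt set \<Rightarrow> ('u elt \<Rightarrow> 'u scat) \<Rightarrow> 'u scat" where
  "coprod_cat I A = mk_cat {Pr i a |i a. i \<in> I \<and> a \<in> Obj (A i)} {Pr i f |i f. i \<in> I \<and> f \<in> Arr (A i)}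
     (\<lambda>f. Pr (pfst f) (Dom (A (pfst f)) (psnd f)))
     (\<lambda>f. Pr (pfst f) (Cod (A (pfst f)) (psnd f)))
     (\<lambda>x. Pr (pfst x) (Idn (A (pfst x)) (psnd x)))
     (\<lambda>g f. Pr (pfst f) (Comp (A (pfst f)) (psnd g) (psnd f)))"

definition coprod_in :: "'u elt set \<Rightarrow> ('u elt \<Rightarrow> 'u scat) \<Rightarrow> 'u elt \<Rightarrow> 'u sftor" where
  "coprod_in I A i = mk_ftor (A i) (coprod_cat I A) (Pr i) (Pr i)"

text \<open>
  Comma category of \<open>u : A \<rightarrow> C\<close> and \<open>v : B \<rightarrow> C\<close>. Objects \<open>Pr (Pr a b) f\<close> are arrows
  \<open>f : u a \<rightarrow> v b\<close>; an arrow \<open>Pr (Pr x y) (Pr h k)\<close> from x to y is a pair of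
  arrows h of A and k of B making the evident square commute.
\<close>

definition comma_cat :: "'u sftor \<Rightarrow> 'u sftor \<Rightarrow> 'u scat" where
  "comma_cat u v = mk_cat
     {Pr (Pr a b) f |a b f. a \<in> Obj (Src u) \<and> b \<in> Obj (Src v) \<and> in_hom (Tgt u) f (Om u a) (Om v b)}
     {Pr (Pr (Pr (Pr a b) f) (Pr (Pr a' b') f')) (Pr h k) |a b f a' b' f' h k.
        in_hom (Src u) h a a' \<and> in_hom (Src v) k b b' \<and>
        in_hom (Tgt u) f (Om u a) (Om v b) \<and> in_hom (Tgt u) f' (Om u a') (Om v b') \<and>
        Comp (Tgt u) f' (Am u h) = Comp (Tgt u) (Am v k) f}
     (\<lambda>m. pfst (pfst m))
     (\<lambda>m. psnd (pfst m))
     (\<lambda>x. Pr (Pr x x) (Pr (Idn (Src u) (pfst (pfst x))) (Idn (Src v) (psnd (pfst x)))))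
     (\<lambda>n m. Pr (Pr (pfst (pfst m)) (psnd (pfst n)))
        (Pr (Comp (Src u) (pfst (psnd n)) (pfst (psnd m))) (Comp (Src v) (psnd (psnd n)) (psnd (psnd m)))))"

definition comma_fst :: "'u sftor \<Rightarrow> 'u sftor \<Rightarrow> 'u sftor" where
  "comma_fst u v = mk_ftor (comma_cat u v) (Src u) (\<lambda>x. pfst (pfst x)) (\<lambda>m. pfst (psnd m))"

definition comma_snd :: "'u sftor \<Rightarrow> 'u sftor \<Rightarrow> 'u sftor" where
  "comma_snd u v = mk_ftor (comma_cat u v) (Src v) (\<lambda>x. psnd (pfst x)) (\<lambda>m. psnd (psnd m))"

definition comma_cell :: "'u sftor \<Rightarrow> 'u sftor \<Rightarrow> 'u sntr" where
  "comma_cell u v = mk_ntr (u \<odot> comma_fst u v) (v \<odot> comma_snd u v) psnd"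

text \<open>The slice category \<open>(u/b)\<close> is the comma category of u and \<open>b : 1 \<rightarrow> B\<close>; \<open>(b/u)\<close> dually.\<close>

abbreviation over_cat :: "'u sftor \<Rightarrow> 'u elt \<Rightarrow> 'u scat" where
  "over_cat u b \<equiv> comma_cat u (pt (Tgt u) b)"

abbreviation under_cat :: "'u elt \<Rightarrow> 'u sftor \<Rightarrow> 'u scat" where
  "under_cat b u \<equiv> comma_cat (pt (Tgt u) b) u"


section \<open>Derivators\<close>

record ('u, 'o, 'm) prederiv =
  DC :: "'u scat \<Rightarrow> ('o, 'm) cat"
  DF :: "'u sftor \<Rightarrow> ('o, 'm, 'o, 'm) ftor"  \<comment> \<open>\<open>DF D u\<close> is the restriction along u\<close>
  DN :: "'u sntr \<Rightarrow> ('o, 'm, 'o, 'm) ntr"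

definition prederivator :: "('u elt set \<Rightarrow> bool) \<Rightarrow> ('u, 'o, 'm) prederiv \<Rightarrow> bool" where
  "prederivator S D \<longleftrightarrow>
     (\<forall>A. small_cat S A \<longrightarrow> category (DC D A)) \<and>
     (\<forall>u A B. small_ftor S u A B \<longrightarrow> is_ftor (DF D u) (DC D B) (DC D A)) \<and>
     (\<forall>A. small_cat S A \<longrightarrow> DF D (id_ftor A) = id_ftor (DC D A)) \<and>
     (\<forall>u v A B C. small_ftor S u A B \<and> small_ftor S v B C \<longrightarrow> DF D (v \<odot> u) = DF D u \<odot> DF D v) \<and>
     (\<forall>t u v A B. small_ftor S u A B \<and> is_ntr t u v \<longrightarrow> is_ntr (DN D t) (DF D u) (DF D v)) \<and>
     (\<forall>u A B. small_ftor S u A B \<longrightarrow> DN D (id_ntr u) = id_ntr (DF D u)) \<and>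
     (\<forall>s t u v w A B. small_ftor S u A B \<and> is_ntr s u v \<and> is_ntr t v w \<longrightarrow>
        DN D (t \<cdot> s) = DN D t \<cdot> DN D s) \<and>
     (\<forall>s t u u' v v' A B C. small_ftor S u A B \<and> is_ntr s u u' \<and> small_ftor S v B C \<and> is_ntr t v v' \<longrightarrow>
        DN D (hcomp t s) = hcomp (DN D s) (DN D t))"

definition prod_cat :: "'i set \<Rightarrow> ('i \<Rightarrow> ('o, 'm) cat) \<Rightarrow> ('i \<Rightarrow> 'o, 'i \<Rightarrow> 'm) cat" where
  "prod_cat I C = mk_cat (PiE I (\<lambda>i. Obj (C i))) (PiE I (\<lambda>i. Arr (C i)))
     (\<lambda>f. \<lambda>i\<in>I. Dom (C i) (f i)) (\<lambda>f. \<lambda>i\<in>I. Cod (C i) (f i)) (\<lambda>x. \<lambda>i\<in>I. Idn (C i) (x i))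
     (\<lambda>g f. \<lambda>i\<in>I. Comp (C i) (g i) (f i))"

definition der1 :: "('u elt set \<Rightarrow> bool) \<Rightarrow> ('u, 'o, 'm) prederiv \<Rightarrow> bool" where
  "der1 S D \<longleftrightarrow> (\<forall>I A. S I \<and> (\<forall>i\<in>I. small_cat S (A i)) \<longrightarrow>
     equivalence_ftor
       (mk_ftor (DC D (coprod_cat I A)) (prod_cat I (\<lambda>i. DC D (A i)))
          (\<lambda>x. \<lambda>i\<in>I. Om (DF D (coprod_in I A i)) x)
          (\<lambda>f. \<lambda>i\<in>I. Am (DF D (coprod_in I A i)) f))
       (DC D (coprod_cat I A)) (prod_cat I (\<lambda>i. DC D (A i))))"

definition der2 :: "('u elt set \<Rightarrow> bool) \<Rightarrow> ('u, 'o, 'm) prederiv \<Rightarrow> bool" where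
  "der2 S D \<longleftrightarrow> (\<forall>A. small_cat S A \<longrightarrow> (\<forall>f\<in>Arr (DC D A).
     iso_arr (DC D A) f \<longleftrightarrow> (\<forall>a\<in>Obj A. iso_arr (DC D one_cat) (Am (DF D (pt A a)) f))))"

text \<open>Left and right Kan extension along u, as adjunctions \<open>u_! \<stileturn> u^*\<close>, \<open>u^* \<stileturn> u_*\<close>.\<close>

definition left_kan :: "('u, 'o, 'm) prederiv \<Rightarrow> 'u sftor \<Rightarrow> ('o, 'm, 'o, 'm) adj \<Rightarrow> bool" where
  "left_kan D u K \<longleftrightarrow> adjunction K \<and> RAdj K = DF D u"

definition right_kan :: "('u, 'o, 'm) prederiv \<Rightarrow> 'u sftor \<Rightarrow> ('o, 'm, 'o, 'm) adj \<Rightarrow> bool" where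
  "right_kan D u K \<longleftrightarrow> adjunction K \<and> LAdj K = DF D u"

definition der3 :: "('u elt set \<Rightarrow> bool) \<Rightarrow> ('u, 'o, 'm) prederiv \<Rightarrow> bool" where
  "der3 S D \<longleftrightarrow> (\<forall>u A B. small_ftor S u A B \<longrightarrow> (\<exists>K. left_kan D u K) \<and> (\<exists>K. right_kan D u K))"

text \<open>The comma cells \<open>u p \<Rightarrow> b \<pi>\<close> and \<open>b \<pi> \<Rightarrow> u q\<close> give \<open>p^* u^* \<Rightarrow> \<pi>^* b^*\<close> and
  \<open>\<pi>^* b^* \<Rightarrow> q^* u^*\<close>. The condition does not depend on the choice of adjoints.\<close>

definition der4 :: "('u elt set \<Rightarrow> bool) \<Rightarrow> ('u, 'o, 'm) prederiv \<Rightarrow> bool" where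
  "der4 S D \<longleftrightarrow> (\<forall>u A B. \<forall>b\<in>Obj B. small_ftor S u A B \<longrightarrow>
     (\<forall>K K'. left_kan D u K \<and> left_kan D (bang (over_cat u b)) K' \<longrightarrow>
        is_nat_iso
          (left_mate K K' (DF D (comma_fst u (pt B b))) (DF D (pt B b)) (DN D (comma_cell u (pt B b))))
          (LAdj K' \<odot> DF D (comma_fst u (pt B b))) (DF D (pt B b) \<odot> LAdj K)) \<and>
     (\<forall>K K'. right_kan D u K \<and> right_kan D (bang (under_cat b u)) K' \<longrightarrow>
        is_nat_iso
          (right_mate K K' (DF D (comma_snd (pt B b) u)) (DF D (pt B b)) (DN D (comma_cell (pt B b) u)))
          (DF D (pt B b) \<odot> RAdj K) (RAdj K' \<odot> DF D (comma_snd (pt B b) u))))"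

definition derivator :: "('u elt set \<Rightarrow> bool) \<Rightarrow> ('u, 'o, 'm) prederiv \<Rightarrow> bool" where
  "derivator S D \<longleftrightarrow> prederivator S D \<and> der1 S D \<and> der2 S D \<and> der3 S D \<and> der4 S D"

definition pointed_derivator :: "('u elt set \<Rightarrow> bool) \<Rightarrow> ('u, 'o, 'm) prederiv \<Rightarrow> bool" where
  "pointed_derivator S D \<longleftrightarrow> derivator S D \<and> (\<exists>z. zero_object (DC D one_cat) z)"


section \<open>Morphisms and modifications\<close>

record ('u, 'o, 'm, 'p, 'n) dmor =
  MF :: "'u scat \<Rightarrow> ('o, 'm, 'p, 'n) ftor"
  MC :: "'u sftor \<Rightarrow> ('o, 'm, 'p, 'n) ntr"  \<comment> \<open>\<open>MC F u\<close> is \<open>\<gamma>\<^sub>u : u^* F_B \<Rightarrow> F_A u^*\<close>\<close>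

definition morphism :: "('u elt set \<Rightarrow> bool) \<Rightarrow> ('u, 'o, 'm) prederiv \<Rightarrow> ('u, 'p, 'n) prederiv
    \<Rightarrow> ('u, 'o, 'm, 'p, 'n) dmor \<Rightarrow> bool" where
  "morphism S D E F \<longleftrightarrow>
     (\<forall>A. small_cat S A \<longrightarrow> is_ftor (MF F A) (DC D A) (DC E A)) \<and>
     (\<forall>u A B. small_ftor S u A B \<longrightarrow> is_nat_iso (MC F u) (DF E u \<odot> MF F B) (MF F A \<odot> DF D u)) \<and>
     (\<forall>A. small_cat S A \<longrightarrow> MC F (id_ftor A) = id_ntr (MF F A)) \<and>
     (\<forall>u v A B C. small_ftor S u A B \<and> small_ftor S v B C \<longrightarrow>
        MC F (v \<odot> u) = (MC F u \<triangleleft> DF D v) \<cdot> (DF E u \<triangleright> MC F v)) \<and>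
     (\<forall>t u v A B. small_ftor S u A B \<and> is_ntr t u v \<longrightarrow>
        MC F v \<cdot> (DN E t \<triangleleft> MF F B) = (MF F A \<triangleright> DN D t) \<cdot> MC F u)"

definition modification :: "('u elt set \<Rightarrow> bool) \<Rightarrow> ('u, 'o, 'm) prederiv \<Rightarrow> ('u, 'p, 'n) prederiv
    \<Rightarrow> ('u, 'o, 'm, 'p, 'n) dmor \<Rightarrow> ('u, 'o, 'm, 'p, 'n) dmor
    \<Rightarrow> ('u scat \<Rightarrow> ('o, 'm, 'p, 'n) ntr) \<Rightarrow> bool" where
  "modification S D E F G \<alpha> \<longleftrightarrow>
     (\<forall>A. small_cat S A \<longrightarrow> is_ntr (\<alpha> A) (MF F A) (MF G A)) \<and>
     (\<forall>u A B. small_ftor S u A B \<longrightarrow>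
        MC G u \<cdot> (DF E u \<triangleright> \<alpha> B) = (\<alpha> A \<triangleleft> DF D u) \<cdot> MC F u)"

definition pointed_morphism :: "('u elt set \<Rightarrow> bool) \<Rightarrow> ('u, 'o, 'm) prederiv \<Rightarrow> ('u, 'p, 'n) prederiv
    \<Rightarrow> ('u, 'o, 'm, 'p, 'n) dmor \<Rightarrow> bool" where
  "pointed_morphism S D E F \<longleftrightarrow> morphism S D E F \<and>
     (\<forall>z. zero_object (DC D one_cat) z \<longrightarrow> zero_object (DC E one_cat) (Om (MF F one_cat) z))"

text \<open>For \<open>u : A \<rightarrow> B\<close> and Kan extensions along u chosen in D (KD) and in E (KE), the canonical maps
  \<open>u_! F_A \<Rightarrow> F_B u_!\<close> and \<open>F_B u_* \<Rightarrow> u_* F_A\<close>.\<close>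

definition left_kan_map :: "('o, 'm, 'o, 'm) adj \<Rightarrow> ('p, 'n, 'p, 'n) adj
    \<Rightarrow> ('u, 'o, 'm, 'p, 'n) dmor \<Rightarrow> 'u sftor \<Rightarrow> ('o, 'm, 'p, 'n) ntr" where
  "left_kan_map KD KE F u = left_mate KD KE (MF F (Src u)) (MF F (Tgt u)) (inv_ntr (MC F u))"

definition right_kan_map :: "('o, 'm, 'o, 'm) adj \<Rightarrow> ('p, 'n, 'p, 'n) adj
    \<Rightarrow> ('u, 'o, 'm, 'p, 'n) dmor \<Rightarrow> 'u sftor \<Rightarrow> ('o, 'm, 'p, 'n) ntr" where
  "right_kan_map KD KE F u = right_mate KD KE (MF F (Src u)) (MF F (Tgt u)) (MC F u)"


section \<open>Suspension\<close>

definition square_cat :: "'u scat" where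
  "square_cat = prod2_cat interval_cat interval_cat"

abbreviation v11 :: "'u sftor" where
  "v11 \<equiv> pt square_cat (Pr E1 E1)"

definition corner_incl :: "'u sftor" where
  "corner_incl = full_incl square_cat (- {Pr E1 E1})"

definition corner_cat :: "'u scat" where
  "corner_cat = full_subcat square_cat (- {Pr E1 E1})"

abbreviation corner_pt :: "'u sftor" where
  "corner_pt \<equiv> pt corner_cat (Pr E0 E0)"

text \<open>L is a left Kan extension along \<open>corner_incl\<close>, R a right Kan extension along \<open>corner_pt\<close>.\<close>

definition Susp :: "('u, 'o, 'm) prederiv \<Rightarrow> ('o, 'm, 'o, 'm) adj \<Rightarrow> ('o, 'm, 'o, 'm) adj
    \<Rightarrow> ('o, 'm, 'o, 'm) ftor" where
  "Susp D L R = DF D v11 \<odot> LAdj L \<odot> RAdj R"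

definition susp_comparison :: "('u, 'o, 'm) prederiv \<Rightarrow> ('u, 'p, 'n) prederiv
    \<Rightarrow> ('o, 'm, 'o, 'm) adj \<Rightarrow> ('o, 'm, 'o, 'm) adj \<Rightarrow> ('p, 'n, 'p, 'n) adj \<Rightarrow> ('p, 'n, 'p, 'n) adj
    \<Rightarrow> ('u, 'o, 'm, 'p, 'n) dmor \<Rightarrow> ('o, 'm, 'p, 'n) ntr" where
  "susp_comparison D E LD RD LE RE F =
     (MC F v11 \<triangleleft> (LAdj LD \<odot> RAdj RD)) \<cdot>
     (DF E v11 \<triangleright> (left_kan_map LD LE F corner_incl \<triangleleft> RAdj RD)) \<cdot>
     ((DF E v11 \<odot> LAdj LE) \<triangleright> inv_ntr (right_kan_map RD RE F corner_pt))"

end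

theory Submission
  imports Defs
begin

text \<open>
  The comparison map \<open>\<psi>\<close> is pasted from three canonical maps of a morphism of derivators: the
  structure isomorphism at \<open>(1,1)\<close>, the left mate along the corner inclusion, and the inverse of the
  right mate along the point \<open>(0,0)\<close> of the corner. Each of them is compatible with a modification
  \<open>\<alpha>\<close>: the first by the definition of a modification, and the mates because mates are natural in the
  transformation of which they are taken (\<open>left_mate_natural\<close>, \<open>right_mate_natural\<close>). Pasting the
  three squares, with the third one turned around, gives the square of the theorem.

  Turning the third square around requires the right mate to be invertible, which is where
  (Der1) to (Der4) and pointedness enter (\<open>pointed_right_kan_map_iso\<close>). By (Der2) this is
  tested at the three objects \<open>b\<close> of the corner. At \<open>b = (0,0)\<close> the slice under \<open>b\<close> is a point, so (Der4) makes
  the counits \<open>i\<^sup>* i\<^sub>* \<Rightarrow> id\<close> invertible (\<open>point_counit_iso\<close>), and the mate is conjugate to the structure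
  isomorphism of the morphism. At the other objects the slice is empty, so (Der4) and (Der1) make the
  values of \<open>i\<^sub>* X\<close> terminal (\<open>kan_terminal_outside\<close>). As \<open>F\<close> preserves the zero object, source and
  target of the mate are both terminal there.

  All diagrams are chased in components at an object, where the typing of an arrow is decided by
  rewriting its domain and codomain.
\<close>

section \<open>Components of functors, transformations and adjunctions\<close>

lemma category_rules:
  assumes "category C"
  shows "f \<in> Arr C \<Longrightarrow> Dom C f \<in> Obj C"
    and "f \<in> Arr C \<Longrightarrow> Cod C f \<in> Obj C"
    and "a \<in> Obj C \<Longrightarrow> Idn C a \<in> Arr C"
    and "a \<in> Obj C \<Longrightarrow> Dom C (Idn C a) = a"
    and "a \<in> Obj C \<Longrightarrow> Cod C (Idn C a) = a"
    and "\<lbrakk>f \<in> Arr C; g \<in> Arr C; Cod C f = Dom C g\<rbrakk> \<Longrightarrow> Comp C g f \<in> Arr C"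
    and "\<lbrakk>f \<in> Arr C; g \<in> Arr C; Cod C f = Dom C g\<rbrakk> \<Longrightarrow> Dom C (Comp C g f) = Dom C f"
    and "\<lbrakk>f \<in> Arr C; g \<in> Arr C; Cod C f = Dom C g\<rbrakk> \<Longrightarrow> Cod C (Comp C g f) = Cod C g"
    and "\<lbrakk>f \<in> Arr C; Dom C f = a\<rbrakk> \<Longrightarrow> Comp C f (Idn C a) = f"
    and "\<lbrakk>f \<in> Arr C; Cod C f = b\<rbrakk> \<Longrightarrow> Comp C (Idn C b) f = f"
    and "\<lbrakk>f \<in> Arr C; g \<in> Arr C; h \<in> Arr C; Cod C f = Dom C g; Cod C g = Dom C h\<rbrakk>
      \<Longrightarrow> Comp C (Comp C h g) f = Comp C h (Comp C g f)"
  using assms unfolding category_def in_hom_def by (auto simp: PiE_iff)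

lemmas category_assoc = category_rules(11)

lemma ftor_rules:
  assumes "is_ftor F A B"
  shows "category A" and "category B" and "Src F = A" and "Tgt F = B"
    and "a \<in> Obj A \<Longrightarrow> Om F a \<in> Obj B"
    and "f \<in> Arr A \<Longrightarrow> Am F f \<in> Arr B"
    and "f \<in> Arr A \<Longrightarrow> Dom B (Am F f) = Om F (Dom A f)"
    and "f \<in> Arr A \<Longrightarrow> Cod B (Am F f) = Om F (Cod A f)"
    and "a \<in> Obj A \<Longrightarrow> Am F (Idn A a) = Idn B (Om F a)"
    and "\<lbrakk>f \<in> Arr A; g \<in> Arr A; Cod A f = Dom A g\<rbrakk>
      \<Longrightarrow> Am F (Comp A g f) = Comp B (Am F g) (Am F f)"
  using assms unfolding is_ftor_def in_hom_def by (auto simp: PiE_iff)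

lemma comp_ftor_simps [simp]:
  "Src (G \<odot> F) = Src F" "Tgt (G \<odot> F) = Tgt G"
  "x \<in> Obj (Src F) \<Longrightarrow> Om (G \<odot> F) x = Om G (Om F x)"
  "f \<in> Arr (Src F) \<Longrightarrow> Am (G \<odot> F) f = Am G (Am F f)"
  by (simp_all add: comp_ftor_def mk_ftor_def)

lemma id_ftor_simps [simp]:
  "Src (id_ftor A) = A" "Tgt (id_ftor A) = A"
  "x \<in> Obj A \<Longrightarrow> Om (id_ftor A) x = x"
  "f \<in> Arr A \<Longrightarrow> Am (id_ftor A) f = f"
  by (simp_all add: id_ftor_def mk_ftor_def)

lemma comp_ftor_assoc:
  assumes "is_ftor F A B" and "Src G = B"
  shows "(H \<odot> G) \<odot> F = H \<odot> G \<odot> F"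
  unfolding comp_ftor_def[of "H \<odot> G" F] comp_ftor_def[of H "G \<odot> F"] mk_ftor_def
  using ftor_rules[OF assms(1)] assms(2) by (auto simp: fun_eq_iff)

lemma comp_ftor_id:
  assumes "is_ftor F A B"
  shows "F \<odot> id_ftor A = F" and "id_ftor B \<odot> F = F"
  using assms unfolding is_ftor_def comp_ftor_def mk_ftor_def id_ftor_def
  by (auto simp: fun_eq_iff PiE_iff extensional_def restrict_def intro!: ftor.equality)

lemma is_ftor_id: "category A \<Longrightarrow> is_ftor (id_ftor A) A A"
  unfolding is_ftor_def id_ftor_def mk_ftor_def in_hom_def
  by (auto simp: category_rules)

lemma is_ftor_comp:
  assumes F: "is_ftor F A B" and G: "is_ftor G B C"
  shows "is_ftor (G \<odot> F) A C"
  using ftor_rules[OF F] ftor_rules[OF G] unfolding is_ftor_def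
  by (auto simp: in_hom_def category_rules comp_ftor_def mk_ftor_def)

lemma ntr_ftor:
  assumes "is_ntr t F G" and "is_ftor F A B"
  shows "is_ftor G A B"
  using assms unfolding is_ntr_def is_ftor_def by auto

lemma ntr_rules:
  assumes "is_ntr t F G" and "is_ftor F A B"
  shows "NSrc t = F" and "NTgt t = G"
    and "x \<in> Obj A \<Longrightarrow> At t x \<in> Arr B"
    and "x \<in> Obj A \<Longrightarrow> Dom B (At t x) = Om F x"
    and "x \<in> Obj A \<Longrightarrow> Cod B (At t x) = Om G x"
    and "f \<in> Arr A \<Longrightarrow> Comp B (At t (Cod A f)) (Am F f) = Comp B (Am G f) (At t (Dom A f))"
  using assms unfolding is_ntr_def is_ftor_def in_hom_def by auto

lemma mk_ntr_simps [simp]: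
  "NSrc (mk_ntr F G t) = F" "NTgt (mk_ntr F G t) = G"
  "x \<in> Obj (Src F) \<Longrightarrow> At (mk_ntr F G t) x = t x"
  by (simp_all add: mk_ntr_def)

lemma id_ntr_simps [simp]:
  "NSrc (id_ntr F) = F" "NTgt (id_ntr F) = F"
  "x \<in> Obj (Src F) \<Longrightarrow> At (id_ntr F) x = Idn (Tgt F) (Om F x)"
  by (simp_all add: id_ntr_def)

lemma vcomp_simps [simp]:
  "NSrc (t \<cdot> s) = NSrc s" "NTgt (t \<cdot> s) = NTgt t"
  "x \<in> Obj (Src (NSrc s)) \<Longrightarrow> At (t \<cdot> s) x = Comp (Tgt (NSrc s)) (At t x) (At s x)"
  by (simp_all add: vcomp_def)

lemma whisker_after_simps [simp]:
  "NSrc (H \<triangleright> t) = H \<odot> NSrc t" "NTgt (H \<triangleright> t) = H \<odot> NTgt t"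
  "x \<in> Obj (Src (NSrc t)) \<Longrightarrow> At (H \<triangleright> t) x = Am H (At t x)"
  by (simp_all add: whisker_after_def)

lemma whisker_before_simps [simp]:
  "NSrc (t \<triangleleft> K) = NSrc t \<odot> K" "NTgt (t \<triangleleft> K) = NTgt t \<odot> K"
  "x \<in> Obj (Src K) \<Longrightarrow> At (t \<triangleleft> K) x = At t (Om K x)"
  by (simp_all add: whisker_before_def)

lemma inv_ntr_simps [simp]:
  "NSrc (inv_ntr t) = NTgt t" "NTgt (inv_ntr t) = NSrc t"
  "x \<in> Obj (Src (NTgt t)) \<Longrightarrow> At (inv_ntr t) x = inv_arr (Tgt (NSrc t)) (At t x)"
  by (simp_all add: inv_ntr_def)

lemma mk_ntr_cong:
  assumes "F = F'" and "G = G'" and "\<And>x. x \<in> Obj (Src F) \<Longrightarrow> t x = t' x"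
  shows "mk_ntr F G t = mk_ntr F' G' t'"
  using assms unfolding mk_ntr_def by (auto simp: restrict_def fun_eq_iff)

text \<open>Transformations are \<open>undefined\<close> off the objects of their source, so a chase of components
  proves an equality of composites.\<close>

lemma vcomp_eqI:
  assumes "NSrc s = NSrc s'" and "NTgt t = NTgt t'"
    and "\<And>x. x \<in> Obj (Src (NSrc s)) \<Longrightarrow> At (t \<cdot> s) x = At (t' \<cdot> s') x"
  shows "t \<cdot> s = t' \<cdot> s'"
  using assms unfolding vcomp_def by (auto intro: mk_ntr_cong)

lemma is_ntr_id:
  assumes F: "is_ftor F A B"
  shows "is_ntr (id_ntr F) F F"
proof -
  note [simp] = ftor_rules[OF F]
  note [simp] = category_rules[OF ftor_rules(2)[OF F]]
  note [simp] = category_rules(1,2)[OF ftor_rules(1)[OF F]]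
  show ?thesis
    unfolding is_ntr_def
    by (rule exI[of _ A], rule exI[of _ B])
      (auto simp: F id_ntr_def mk_ntr_def in_hom_def)
qed

lemma adjunction_ftors:
  assumes "adjunction K" and "is_ftor (LAdj K) A B"
  shows "is_ftor (RAdj K) B A"
  using assms unfolding adjunction_def is_ftor_def by auto

lemma adjunction_ftors':
  assumes "adjunction K" and "is_ftor (RAdj K) B A"
  shows "is_ftor (LAdj K) A B"
  using assms unfolding adjunction_def is_ftor_def by auto

lemma adjunction_rules:
  assumes "adjunction K" and "is_ftor (LAdj K) A B"
  shows "NSrc (Unit K) = id_ftor A" and "NSrc (Counit K) = LAdj K \<odot> RAdj K"
    and "NTgt (Unit K) = RAdj K \<odot> LAdj K" and "NTgt (Counit K) = id_ftor B"
    and "x \<in> Obj A \<Longrightarrow> At (Unit K) x \<in> Arr A"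
    and "x \<in> Obj A \<Longrightarrow> Dom A (At (Unit K) x) = x"
    and "x \<in> Obj A \<Longrightarrow> Cod A (At (Unit K) x) = Om (RAdj K) (Om (LAdj K) x)"
    and "y \<in> Obj B \<Longrightarrow> At (Counit K) y \<in> Arr B"
    and "y \<in> Obj B \<Longrightarrow> Dom B (At (Counit K) y) = Om (LAdj K) (Om (RAdj K) y)"
    and "y \<in> Obj B \<Longrightarrow> Cod B (At (Counit K) y) = y"
    and "x \<in> Obj A \<Longrightarrow>
      Comp B (At (Counit K) (Om (LAdj K) x)) (Am (LAdj K) (At (Unit K) x)) = Idn B (Om (LAdj K) x)"
    and "y \<in> Obj B \<Longrightarrow>
      Comp A (Am (RAdj K) (At (Counit K) y)) (At (Unit K) (Om (RAdj K) y)) = Idn A (Om (RAdj K) y)"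
    and "f \<in> Arr A \<Longrightarrow>
      Comp A (At (Unit K) (Cod A f)) f = Comp A (Am (RAdj K) (Am (LAdj K) f)) (At (Unit K) (Dom A f))"
    and "g \<in> Arr B \<Longrightarrow>
      Comp B (At (Counit K) (Cod B g)) (Am (LAdj K) (Am (RAdj K) g)) = Comp B g (At (Counit K) (Dom B g))"
proof -
  have R: "is_ftor (RAdj K) B A"
    by (rule adjunction_ftors[OF assms])
  obtain A' B' where "is_ftor (LAdj K) A' B'"
    and u: "is_ntr (Unit K) (id_ftor A') (RAdj K \<odot> LAdj K)"
    and c: "is_ntr (Counit K) (LAdj K \<odot> RAdj K) (id_ftor B')"
    and t1: "(Counit K \<triangleleft> LAdj K) \<cdot> (LAdj K \<triangleright> Unit K) = id_ntr (LAdj K)"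
    and t2: "(RAdj K \<triangleright> Counit K) \<cdot> (Unit K \<triangleleft> RAdj K) = id_ntr (RAdj K)"
    using assms(1) unfolding adjunction_def by blast
  then have [simp]: "A' = A" "B' = B"
    using assms(2) unfolding is_ftor_def by auto
  note [simp] = ftor_rules[OF R] ftor_rules[OF assms(2)]
  note [simp] = category_rules(1,2)[OF ftor_rules(1)[OF assms(2)]]
    category_rules(1,2)[OF ftor_rules(2)[OF assms(2)]]
  have idA: "is_ftor (id_ftor A) A A"
    by (rule is_ftor_id) simp
  have LR: "is_ftor (LAdj K \<odot> RAdj K) B B"
    using c unfolding is_ntr_def is_ftor_def by auto
  note U = ntr_rules[OF u[simplified \<open>A' = A\<close>] idA]
  note C = ntr_rules[OF c[simplified \<open>B' = B\<close>] LR]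
  note [simp] = U(1-5) C(1-5)
  show "NSrc (Unit K) = id_ftor A" "NSrc (Counit K) = LAdj K \<odot> RAdj K"
    "NTgt (Unit K) = RAdj K \<odot> LAdj K" "NTgt (Counit K) = id_ftor B"
    "x \<in> Obj A \<Longrightarrow> At (Unit K) x \<in> Arr A"
    "x \<in> Obj A \<Longrightarrow> Dom A (At (Unit K) x) = x"
    "x \<in> Obj A \<Longrightarrow> Cod A (At (Unit K) x) = Om (RAdj K) (Om (LAdj K) x)"
    "y \<in> Obj B \<Longrightarrow> At (Counit K) y \<in> Arr B"
    "y \<in> Obj B \<Longrightarrow> Dom B (At (Counit K) y) = Om (LAdj K) (Om (RAdj K) y)"
    "y \<in> Obj B \<Longrightarrow> Cod B (At (Counit K) y) = y"
    by simp_all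
  show "Comp B (At (Counit K) (Om (LAdj K) x)) (Am (LAdj K) (At (Unit K) x)) = Idn B (Om (LAdj K) x)"
    if "x \<in> Obj A"
    using arg_cong[OF t1, of "\<lambda>t. At t x"] that by simp
  show "Comp A (Am (RAdj K) (At (Counit K) y)) (At (Unit K) (Om (RAdj K) y)) = Idn A (Om (RAdj K) y)"
    if "y \<in> Obj B"
    using arg_cong[OF t2, of "\<lambda>t. At t y"] that by simp
  show "f \<in> Arr A \<Longrightarrow>
      Comp A (At (Unit K) (Cod A f)) f = Comp A (Am (RAdj K) (Am (LAdj K) f)) (At (Unit K) (Dom A f))"
    using U(6)[of f] by simp
  show "g \<in> Arr B \<Longrightarrow>
      Comp B (At (Counit K) (Cod B g)) (Am (LAdj K) (Am (RAdj K) g)) = Comp B g (At (Counit K) (Dom B g))"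
    using C(6)[of g] by simp
qed

text \<open>Strictly inverse functors are adjoint with identity unit and counit; this supplies an explicit
  Kan extension along an isomorphism of categories.\<close>

lemma inverse_adjunction:
  assumes L: "is_ftor L A B" and R: "is_ftor R B A"
    and RL: "R \<odot> L = id_ftor A" and LR: "L \<odot> R = id_ftor B"
  shows "adjunction \<lparr>LAdj = L, RAdj = R, Unit = id_ntr (id_ftor A), Counit = id_ntr (id_ftor B)\<rparr>"
proof -
  have A: "category A" and B: "category B"
    using ftor_rules[OF L] by auto
  note [simp] = ftor_rules(3-9)[OF L] ftor_rules(3-9)[OF R] category_rules(1-10)[OF A]
    category_rules(1-10)[OF B] comp_ftor_id[OF L] comp_ftor_id[OF R]
  have "(id_ntr (id_ftor B) \<triangleleft> L) \<cdot> (L \<triangleright> id_ntr (id_ftor A)) = id_ntr L"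
    "(R \<triangleright> id_ntr (id_ftor B)) \<cdot> (id_ntr (id_ftor A) \<triangleleft> R) = id_ntr R"
    unfolding vcomp_def id_ntr_def[of L] id_ntr_def[of R] by (rule mk_ntr_cong; simp)+
  then show ?thesis
    unfolding adjunction_def using L R is_ntr_id[OF is_ftor_id[OF A]] is_ntr_id[OF is_ftor_id[OF B]]
    by (intro exI[of _ A] exI[of _ B]) (simp add: RL LR)
qed


section \<open>Isomorphisms and terminal objects\<close>

lemma inverse_arr_unique:
  assumes C: "category C" and g: "inverse_arr C f g" and h: "inverse_arr C f h"
  shows "g = h"
proof -
  note r = category_rules[OF C]
  have [simp]: "f \<in> Arr C" "g \<in> Arr C" "Dom C g = Cod C f" "Cod C g = Dom C f"
    "h \<in> Arr C" "Dom C h = Cod C f" "Cod C h = Dom C f"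
    using g h unfolding inverse_arr_def in_hom_def by auto
  have "g = Comp C g (Comp C f h)"
    using h r(9) unfolding inverse_arr_def by simp
  also have "\<dots> = Comp C (Comp C g f) h"
    by (rule r(11)[symmetric]) simp_all
  also have "\<dots> = h"
    using g r(10) unfolding inverse_arr_def by simp
  finally show ?thesis .
qed

lemma inv_arr_rules:
  assumes C: "category C" and "iso_arr C f"
  shows "f \<in> Arr C" and "inv_arr C f \<in> Arr C"
    and "Dom C (inv_arr C f) = Cod C f" and "Cod C (inv_arr C f) = Dom C f"
    and "Comp C (inv_arr C f) f = Idn C (Dom C f)" and "Comp C f (inv_arr C f) = Idn C (Cod C f)"
    and "iso_arr C (inv_arr C f)"
proof -
  have *: "inverse_arr C f (inv_arr C f)"
    using assms(2) unfolding inv_arr_def iso_arr_def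
    by (metis (no_types, lifting) C inverse_arr_unique theI)
  then show "f \<in> Arr C" "inv_arr C f \<in> Arr C" "Dom C (inv_arr C f) = Cod C f"
    "Cod C (inv_arr C f) = Dom C f"
    "Comp C (inv_arr C f) f = Idn C (Dom C f)" "Comp C f (inv_arr C f) = Idn C (Cod C f)"
    unfolding inverse_arr_def in_hom_def by auto
  show "iso_arr C (inv_arr C f)"
    using * unfolding iso_arr_def inverse_arr_def in_hom_def by (intro exI[of _ f]) auto
qed

lemma iso_arr_Comp:
  assumes C: "category C" and f: "iso_arr C f" and g: "iso_arr C g" and d: "Cod C f = Dom C g"
  shows "iso_arr C (Comp C g f)"
proof -
  note r = category_rules[OF C]
  let ?f = "inv_arr C f" and ?g = "inv_arr C g"
  note [simp] = r(1-10) inv_arr_rules[OF C f] inv_arr_rules[OF C g] d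
  have "Comp C (Comp C ?f ?g) (Comp C g f) = Comp C ?f (Comp C (Comp C ?g g) f)"
    by (simp add: r(11) del: inv_arr_rules(5)[OF C g])
  moreover have "Comp C (Comp C g f) (Comp C ?f ?g) = Comp C g (Comp C (Comp C f ?f) ?g)"
    by (simp add: r(11) del: inv_arr_rules(6)[OF C f])
  ultimately have "inverse_arr C (Comp C g f) (Comp C ?f ?g)"
    unfolding inverse_arr_def in_hom_def by simp
  then show ?thesis
    unfolding iso_arr_def by blast
qed

lemma iso_arr_cancel_left:
  assumes C: "category C" and f: "f \<in> Arr C" and g: "iso_arr C g" and d: "Cod C f = Dom C g"
    and gf: "iso_arr C (Comp C g f)"
  shows "iso_arr C f"
proof -
  note [simp] = category_rules(1-10)[OF C] inv_arr_rules[OF C g] f d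
  have "f = Comp C (Comp C (inv_arr C g) g) f"
    by simp
  also have "\<dots> = Comp C (inv_arr C g) (Comp C g f)"
    by (rule category_assoc[OF C]) simp_all
  finally show ?thesis
    using iso_arr_Comp[OF C gf inv_arr_rules(7)[OF C g]] by simp
qed

lemma ftor_iso_arr:
  assumes F: "is_ftor F A B" and f: "iso_arr A f"
  shows "iso_arr B (Am F f)"
proof -
  note r = ftor_rules[OF F]
  note [simp] = r(5-9) category_rules(1,2)[OF r(1)] inv_arr_rules[OF r(1) f]
  have "inverse_arr B (Am F f) (Am F (inv_arr A f))"
    unfolding inverse_arr_def in_hom_def by (simp add: r(10)[symmetric])
  then show ?thesis
    unfolding iso_arr_def by blast
qed

text \<open>Reversing both vertical isomorphisms of a commutative square leaves it commutative; this is
  what carries compatibility with a transformation over to its inverse.\<close>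

lemma inv_arr_square:
  assumes C: "category C" and s: "iso_arr C s" and t: "iso_arr C t"
    and p: "p \<in> Arr C" "Dom C p = Dom C s" "Cod C p = Dom C t"
    and q: "q \<in> Arr C" "Dom C q = Cod C s" "Cod C q = Cod C t"
    and sq: "Comp C q s = Comp C t p"
  shows "Comp C p (inv_arr C s) = Comp C (inv_arr C t) q"
proof -
  note [simp] = category_rules(1-10)[OF C] inv_arr_rules[OF C s] inv_arr_rules[OF C t] p q
  note a = category_assoc[OF C]
  let ?s = "inv_arr C s" and ?t = "inv_arr C t"
  have "Comp C p ?s = Comp C (Comp C (Comp C ?t t) p) ?s"
    by simp
  also have "\<dots> = Comp C ?t (Comp C (Comp C t p) ?s)"
    by (simp add: a del: inv_arr_rules(5)[OF C t])
  also have "\<dots> = Comp C ?t (Comp C q (Comp C s ?s))"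
    unfolding sq[symmetric] by (simp add: a del: inv_arr_rules(6)[OF C s])
  also have "\<dots> = Comp C ?t q"
    by simp
  finally show ?thesis .
qed

lemma is_ntr_inv:
  assumes t: "is_nat_iso t F G" and F: "is_ftor F A B"
  shows "is_ntr (inv_ntr t) G F"
proof -
  have n: "is_ntr t F G"
    using t unfolding is_nat_iso_def by auto
  note G = ntr_ftor[OF n F]
  have B: "category B"
    using ftor_rules[OF F] by auto
  note [simp] = ftor_rules(3-9)[OF F] ftor_rules(3-9)[OF G] ntr_rules(1-5)[OF n F]
    category_rules(1,2)[OF ftor_rules(1)[OF F]]
  have i: "iso_arr B (At t x)" if "x \<in> Obj A" for x
    using t that unfolding is_nat_iso_def by simp
  note [simp] = inv_arr_rules(2-4)[OF B i]
  have nat: "Comp B (inv_arr B (At t y)) (Am G f) = Comp B (Am F f) (inv_arr B (At t x))"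
    if "in_hom A f x y" for f x y
  proof -
    have [simp]: "f \<in> Arr A" "Dom A f = x" "Cod A f = y" "x \<in> Obj A" "y \<in> Obj A"
      using that category_rules(1,2)[OF ftor_rules(1)[OF F], of f] unfolding in_hom_def by auto
    show ?thesis
      by (rule inv_arr_square[OF B i i, symmetric]) (simp_all add: ntr_rules(6)[OF n F, of f, simplified])
  qed
  have [simp]: "x \<in> Obj A" "y \<in> Obj A" if "in_hom A f x y" for f x y
    using that category_rules(1,2)[OF ftor_rules(1)[OF F], of f] unfolding in_hom_def by auto
  show ?thesis
    unfolding is_ntr_def
    by (rule exI[of _ A], rule exI[of _ B])
      (auto simp: F G nat in_hom_def[of B] inv_ntr_def mk_ntr_def)
qed

definition terminal_object :: "('o, 'm) cat \<Rightarrow> 'o \<Rightarrow> bool" where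
  "terminal_object C z \<longleftrightarrow> z \<in> Obj C \<and> (\<forall>x\<in>Obj C. \<exists>!f. in_hom C f x z)"

lemma zero_imp_terminal: "zero_object C z \<Longrightarrow> terminal_object C z"
  unfolding zero_object_def terminal_object_def by blast

lemma terminal_unique:
  assumes "terminal_object C z" and "f \<in> Arr C" and "g \<in> Arr C"
    and "Dom C f \<in> Obj C" and "Dom C f = Dom C g" and "Cod C f = z" and "Cod C g = z"
  shows "f = g"
  using assms unfolding terminal_object_def in_hom_def by metis

lemma terminal_obtain:
  assumes "terminal_object C z" and "x \<in> Obj C"
  obtains f where "f \<in> Arr C" and "Dom C f = x" and "Cod C f = z"
  using assms unfolding terminal_object_def in_hom_def by metis

lemma terminal_iso_arr:
  assumes C: "category C" and y: "terminal_object C y" and z: "terminal_object C z"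
    and f: "f \<in> Arr C" "Dom C f = y" "Cod C f = z"
  shows "iso_arr C f"
proof -
  note [simp] = category_rules(1-10)[OF C] f
  have [simp]: "y \<in> Obj C" "z \<in> Obj C"
    using y z unfolding terminal_object_def by auto
  obtain g where [simp]: "g \<in> Arr C" "Dom C g = z" "Cod C g = y"
    using terminal_obtain[OF y \<open>z \<in> Obj C\<close>] by blast
  have "Comp C g f = Idn C y" "Comp C f g = Idn C z"
    by (rule terminal_unique[OF y]; simp) (rule terminal_unique[OF z]; simp)
  then have "inverse_arr C f g"
    unfolding inverse_arr_def in_hom_def by simp
  then show ?thesis
    unfolding iso_arr_def by blast
qed

lemma terminal_iso_closed:
  assumes C: "category C" and z: "terminal_object C z" and f: "iso_arr C f" and "Cod C f = z"
  shows "terminal_object C (Dom C f)"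
proof -
  note [simp] = category_rules(1-10)[OF C] inv_arr_rules[OF C f] \<open>Cod C f = z\<close>
  have "\<exists>!g. in_hom C g x (Dom C f)" if x: "x \<in> Obj C" for x
  proof -
    obtain h where [simp]: "h \<in> Arr C" "Dom C h = x" "Cod C h = z"
      using terminal_obtain[OF z x] by blast
    show ?thesis
    proof (rule ex1I[of _ "Comp C (inv_arr C f) h"])
      show "in_hom C (Comp C (inv_arr C f) h) x (Dom C f)"
        unfolding in_hom_def by simp
      fix g assume "in_hom C g x (Dom C f)"
      then have [simp]: "g \<in> Arr C" "Dom C g = x" "Cod C g = Dom C f"
        unfolding in_hom_def by auto
      have "Comp C f g = h"
        by (rule terminal_unique[OF z]) (simp_all add: x)
      then have "Comp C (inv_arr C f) h = Comp C (Comp C (inv_arr C f) f) g"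
        using category_assoc[OF C, of g f "inv_arr C f"] by simp
      then show "g = Comp C (inv_arr C f) h"
        by simp
    qed
  qed
  then show ?thesis
    unfolding terminal_object_def by simp
qed

text \<open>An arrow \<open>x \<rightarrow> R y\<close> is determined by its adjunct \<open>L x \<rightarrow> y\<close>, of which there is exactly
  one.\<close>

lemma right_adjoint_terminal:
  assumes K: "adjunction K" and L: "is_ftor (LAdj K) A B" and y: "terminal_object B y"
  shows "terminal_object A (Om (RAdj K) y)"
proof -
  have R: "is_ftor (RAdj K) B A"
    by (rule adjunction_ftors[OF K L])
  have A: "category A" and B: "category B"
    using ftor_rules[OF L] by auto
  have y' [simp]: "y \<in> Obj B"
    using y unfolding terminal_object_def by auto
  note adj = adjunction_rules[OF K L]
  note [simp] = ftor_rules[OF L] ftor_rules[OF R] category_rules(1-10)[OF A]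
    category_rules(1-10)[OF B] adj(5-10,12)
  have "\<exists>!g. in_hom A g x (Om (RAdj K) y)" if x [simp]: "x \<in> Obj A" for x
  proof -
    obtain f where f [simp]: "f \<in> Arr B" "Dom B f = Om (LAdj K) x" "Cod B f = y"
      by (rule terminal_obtain[OF y, of "Om (LAdj K) x"]) auto
    show ?thesis
    proof (rule ex1I[of _ "Comp A (Am (RAdj K) f) (At (Unit K) x)"])
      show "in_hom A (Comp A (Am (RAdj K) f) (At (Unit K) x)) x (Om (RAdj K) y)"
        unfolding in_hom_def by simp
      fix g assume "in_hom A g x (Om (RAdj K) y)"
      then have [simp]: "g \<in> Arr A" "Dom A g = x" "Cod A g = Om (RAdj K) y"
        unfolding in_hom_def by auto
      have "f = Comp B (At (Counit K) y) (Am (LAdj K) g)"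
        by (rule terminal_unique[OF y]) simp_all
      then have "Comp A (Am (RAdj K) f) (At (Unit K) x)
          = Comp A (Am (RAdj K) (At (Counit K) y)) (Comp A (Am (RAdj K) (Am (LAdj K) g)) (At (Unit K) x))"
        by (simp add: category_assoc[OF A])
      also have "\<dots> = Comp A (Am (RAdj K) (At (Counit K) y)) (Comp A (At (Unit K) (Om (RAdj K) y)) g)"
        using adj(13)[of g] by simp
      also have "\<dots> = g"
        by (subst category_assoc[OF A, symmetric]) simp_all
      finally show "g = Comp A (Am (RAdj K) f) (At (Unit K) x)" ..
    qed
  qed
  then show ?thesis
    unfolding terminal_object_def by simp
qed

text \<open>If \<open>s : id \<cong> G F\<close>, an arrow \<open>f : x \<rightarrow> y\<close> equals \<open>s\<^sub>y\<inverse> \<circ> G F f \<circ> s\<^sub>x\<close>. When \<open>F\<close> lands in a category with one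
  arrow, this does not depend on \<open>f\<close>, and it makes sense without \<open>f\<close>.\<close>

lemma equivalence_trivial_terminal:
  assumes eq: "equivalence_ftor F A B" and "Obj B = {b}" and "Arr B = {k}" and y: "y \<in> Obj A"
  shows "terminal_object A y"
proof -
  obtain G s where F: "is_ftor F A B" and G: "is_ftor G B A"
    and s: "is_nat_iso s (id_ftor A) (G \<odot> F)"
    using eq unfolding equivalence_ftor_def by blast
  have A: "category A"
    using ftor_rules[OF F] by auto
  note [simp] = category_rules(1-10)[OF A] ftor_rules[OF F] ftor_rules[OF G]
  have n: "is_ntr s (id_ftor A) (G \<odot> F)"
    using s unfolding is_nat_iso_def by auto
  note nat = ntr_rules[OF n is_ftor_id[OF A]]
  note [simp] = nat(3-5)
  have i: "iso_arr A (At s x)" if "x \<in> Obj A" for x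
    using s that unfolding is_nat_iso_def by simp
  note [simp] = inv_arr_rules[OF A i]
  have FO: "Om F x = b" if "x \<in> Obj A" for x
    using ftor_rules(5)[OF F that] assms by auto
  have FA: "Am F f = k" if "f \<in> Arr A" for f
    using ftor_rules(6)[OF F that] assms by auto
  have "\<exists>!f. in_hom A f x y" if x: "x \<in> Obj A" for x
  proof (rule ex_ex1I)
    show "\<exists>f. in_hom A f x y"
      using x y by (intro exI[of _ "Comp A (inv_arr A (At s y)) (At s x)"]) (simp add: in_hom_def FO)
  next
    have *: "f = Comp A (inv_arr A (At s y)) (Comp A (Am G k) (At s x))" if "in_hom A f x y" for f
    proof -
      have [simp]: "f \<in> Arr A" "Dom A f = x" "Cod A f = y"
        using that unfolding in_hom_def by auto
      have "f = Comp A (Comp A (inv_arr A (At s y)) (At s y)) f"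
        using x y by simp
      also have "\<dots> = Comp A (inv_arr A (At s y)) (Comp A (At s y) f)"
        using x y by (intro category_assoc[OF A]) simp_all
      also have "Comp A (At s y) f = Comp A (Am G k) (At s x)"
        using nat(6)[of f] by (simp add: FA)
      finally show ?thesis .
    qed
    show "f = g" if "in_hom A f x y" "in_hom A g x y" for f g
      using *[OF that(1)] *[OF that(2)] by simp
  qed
  then show ?thesis
    using y unfolding terminal_object_def by simp
qed


section \<open>Mates\<close>

lemma At_left_mate:
  assumes K: "adjunction K" and L: "is_ftor (LAdj K) A B"
    and K': "adjunction K'" and L': "is_ftor (LAdj K') A' B'"
    and P: "is_ftor P A A'" and Q: "is_ftor Q B B'"
    and s: "NSrc s = P \<odot> RAdj K" and x: "x \<in> Obj A"
  shows "At (left_mate K K' P Q s) x =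
    Comp B' (At (Counit K') (Om Q (Om (LAdj K) x)))
      (Comp B' (Am (LAdj K') (At s (Om (LAdj K) x))) (Am (LAdj K') (Am P (At (Unit K) x))))"
proof -
  note R = adjunction_ftors[OF K L]
  note [simp] = ftor_rules[OF L] ftor_rules[OF L'] ftor_rules[OF P] ftor_rules[OF Q] ftor_rules[OF R]
    adjunction_rules(1-10)[OF K L] adjunction_rules(1-10)[OF K' L'] s x
  show ?thesis
    unfolding left_mate_def by simp
qed

lemma At_right_mate:
  assumes K: "adjunction K" and U: "is_ftor (LAdj K) B A"
    and K': "adjunction K'" and U': "is_ftor (LAdj K') B' A'"
    and P: "is_ftor P A A'" and Q: "is_ftor Q B B'"
    and s: "NSrc s = LAdj K' \<odot> Q" and x: "x \<in> Obj A"
  shows "At (right_mate K K' P Q s) x =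
    Comp B' (Am (RAdj K') (Am P (At (Counit K) x)))
      (Comp B' (Am (RAdj K') (At s (Om (RAdj K) x))) (At (Unit K') (Om Q (Om (RAdj K) x))))"
proof -
  note R = adjunction_ftors[OF K U] and R' = adjunction_ftors[OF K' U']
  note [simp] = ftor_rules[OF U] ftor_rules[OF U'] ftor_rules[OF P] ftor_rules[OF Q] ftor_rules[OF R]
    ftor_rules[OF R'] adjunction_rules(1-10)[OF K U] adjunction_rules(1-10)[OF K' U'] s x
  show ?thesis
    unfolding right_mate_def by simp
qed

lemma left_mate_rules:
  assumes K: "adjunction K" and L: "is_ftor (LAdj K) A B"
    and K': "adjunction K'" and L': "is_ftor (LAdj K') A' B'"
    and P: "is_ftor P A A'" and Q: "is_ftor Q B B'"
    and s: "is_ntr s (P \<odot> RAdj K) (RAdj K' \<odot> Q)" "is_ftor (P \<odot> RAdj K) B A'" and x: "x \<in> Obj A"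
  shows "At (left_mate K K' P Q s) x \<in> Arr B'"
    and "Dom B' (At (left_mate K K' P Q s) x) = Om (LAdj K') (Om P x)"
    and "Cod B' (At (left_mate K K' P Q s) x) = Om Q (Om (LAdj K) x)"
proof -
  note R = adjunction_ftors[OF K L] and R' = adjunction_ftors[OF K' L']
  note [simp] = ftor_rules(1-9)[OF L] ftor_rules(1-9)[OF L'] ftor_rules(1-9)[OF P] ftor_rules(1-9)[OF Q]
    ftor_rules(1-9)[OF R] ftor_rules(1-9)[OF R'] ntr_rules(1-5)[OF s] x
    adjunction_rules(5-10)[OF K L] adjunction_rules(5-10)[OF K' L']
    category_rules(6-8)[OF ftor_rules(2)[OF L']]
    At_left_mate[OF K L K' L' P Q ntr_rules(1)[OF s] x]
  show "At (left_mate K K' P Q s) x \<in> Arr B'"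
    "Dom B' (At (left_mate K K' P Q s) x) = Om (LAdj K') (Om P x)"
    "Cod B' (At (left_mate K K' P Q s) x) = Om Q (Om (LAdj K) x)"
    by simp_all
qed

lemma right_mate_rules:
  assumes K: "adjunction K" and U: "is_ftor (LAdj K) B A"
    and K': "adjunction K'" and U': "is_ftor (LAdj K') B' A'"
    and P: "is_ftor P A A'" and Q: "is_ftor Q B B'"
    and s: "is_ntr s (LAdj K' \<odot> Q) (P \<odot> LAdj K)" "is_ftor (LAdj K' \<odot> Q) B A'" and x: "x \<in> Obj A"
  shows "At (right_mate K K' P Q s) x \<in> Arr B'"
    and "Dom B' (At (right_mate K K' P Q s) x) = Om Q (Om (RAdj K) x)"
    and "Cod B' (At (right_mate K K' P Q s) x) = Om (RAdj K') (Om P x)"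
proof -
  note R = adjunction_ftors[OF K U] and R' = adjunction_ftors[OF K' U']
  note [simp] = ftor_rules(1-9)[OF U] ftor_rules(1-9)[OF U'] ftor_rules(1-9)[OF P] ftor_rules(1-9)[OF Q]
    ftor_rules(1-9)[OF R] ftor_rules(1-9)[OF R'] ntr_rules(1-5)[OF s] x
    adjunction_rules(5-10)[OF K U] adjunction_rules(5-10)[OF K' U']
    category_rules(6-8)[OF ftor_rules(1)[OF U']]
    At_right_mate[OF K U K' U' P Q ntr_rules(1)[OF s] x]
  show "At (right_mate K K' P Q s) x \<in> Arr B'"
    "Dom B' (At (right_mate K K' P Q s) x) = Om Q (Om (RAdj K) x)"
    "Cod B' (At (right_mate K K' P Q s) x) = Om (RAdj K') (Om P x)"
    by simp_all
qed

text \<open>In \<open>\<epsilon>' \<circ> L's \<circ> L'P\<eta>\<close> a pair of transformations \<open>p : P \<Rightarrow> P'\<close>, \<open>q : Q \<Rightarrow> Q'\<close> slides past one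
  factor at a time: past \<open>\<epsilon>'\<close> by its naturality, past \<open>s\<close> by the assumed square, and past \<open>\<eta>\<close> by
  naturality of \<open>p\<close>.\<close>

lemma left_mate_natural:
  assumes K: "adjunction K" and L: "is_ftor (LAdj K) A B"
    and K': "adjunction K'" and L': "is_ftor (LAdj K') A' B'"
    and P: "is_ftor P A A'" and Q: "is_ftor Q B B'"
    and p: "is_ntr p P P'" and q: "is_ntr q Q Q'"
    and s: "is_ntr s (P \<odot> RAdj K) (RAdj K' \<odot> Q)" "is_ftor (P \<odot> RAdj K) B A'"
    and s': "is_ntr s' (P' \<odot> RAdj K) (RAdj K' \<odot> Q')" "is_ftor (P' \<odot> RAdj K) B A'"
    and sq: "\<And>y. y \<in> Obj B \<Longrightarrow>
      Comp A' (Am (RAdj K') (At q y)) (At s y) = Comp A' (At s' y) (At p (Om (RAdj K) y))"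
    and x: "x \<in> Obj A"
  shows "Comp B' (At q (Om (LAdj K) x)) (At (left_mate K K' P Q s) x)
    = Comp B' (At (left_mate K K' P' Q' s') x) (Am (LAdj K') (At p x))"
proof -
  note R = adjunction_ftors[OF K L] and R' = adjunction_ftors[OF K' L']
  note P' = ntr_ftor[OF p P] and Q' = ntr_ftor[OF q Q]
  have B': "category B'" and A': "category A'"
    using ftor_rules[OF L'] by auto
  note [simp] = ftor_rules(1-9)[OF L] ftor_rules(1-9)[OF L'] ftor_rules(1-9)[OF P] ftor_rules(1-9)[OF Q]
    ftor_rules(1-9)[OF P'] ftor_rules(1-9)[OF Q'] ftor_rules(1-9)[OF R] ftor_rules(1-9)[OF R']
    ntr_rules(1-5)[OF s] ntr_rules(1-5)[OF s'] ntr_rules(1-5)[OF p P] ntr_rules(1-5)[OF q Q] x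
    adjunction_rules(5-10)[OF K L] adjunction_rules(5-10)[OF K' L']
    category_rules(6-8)[OF B'] category_rules(6-8)[OF A']
  note comp = ftor_rules(10)[OF L']
  note a = category_assoc[OF B'] and a' = category_assoc[OF A']
  define l where "l = Om (LAdj K) x"
  define \<eta> where "\<eta> = At (Unit K) x"
  have [simp]: "l \<in> Obj B" "\<eta> \<in> Arr A" "Dom A \<eta> = x" "Cod A \<eta> = Om (RAdj K) l"
    by (simp_all add: l_def \<eta>_def)
  let ?e = "\<lambda>Q. At (Counit K') (Om Q l)" and ?L = "Am (LAdj K')" and ?ql = "At q l"
  have nat: "Comp B' ?ql (?e Q) = Comp B' (?e Q') (?L (Am (RAdj K') ?ql))"
    using adjunction_rules(14)[OF K' L', of ?ql] by simp
  have slide: "Comp A' (Am (RAdj K') ?ql) (Comp A' (At s l) (Am P \<eta>))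
      = Comp A' (At s' l) (Comp A' (Am P' \<eta>) (At p x))"
  proof -
    have "Comp A' (Am (RAdj K') ?ql) (Comp A' (At s l) (Am P \<eta>))
        = Comp A' (Comp A' (Am (RAdj K') ?ql) (At s l)) (Am P \<eta>)"
      by (simp add: a')
    also have "\<dots> = Comp A' (At s' l) (Comp A' (At p (Om (RAdj K) l)) (Am P \<eta>))"
      by (simp add: a' sq)
    also have "Comp A' (At p (Om (RAdj K) l)) (Am P \<eta>) = Comp A' (Am P' \<eta>) (At p x)"
      using ntr_rules(6)[OF p P, of \<eta>] by simp
    finally show ?thesis .
  qed
  have "Comp B' ?ql (At (left_mate K K' P Q s) x)
      = Comp B' ?ql (Comp B' (?e Q) (Comp B' (?L (At s l)) (?L (Am P \<eta>))))"
    using At_left_mate[OF K L K' L' P Q _ x, of s] by (simp add: l_def \<eta>_def)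
  also have "\<dots> = Comp B' (Comp B' ?ql (?e Q)) (Comp B' (?L (At s l)) (?L (Am P \<eta>)))"
    by (rule a[symmetric]) simp_all
  also have "\<dots> = Comp B' (?e Q') (?L (Comp A' (Am (RAdj K') ?ql) (Comp A' (At s l) (Am P \<eta>))))"
    unfolding nat by (simp add: a comp)
  also have "\<dots> = Comp B' (Comp B' (?e Q') (Comp B' (?L (At s' l)) (?L (Am P' \<eta>)))) (?L (At p x))"
    unfolding slide by (simp add: a comp)
  also have "Comp B' (?e Q') (Comp B' (?L (At s' l)) (?L (Am P' \<eta>))) = At (left_mate K K' P' Q' s') x"
    using At_left_mate[OF K L K' L' P' Q' _ x, of s'] by (simp add: l_def \<eta>_def)
  finally show ?thesis
    by (simp add: l_def)
qed

lemma right_mate_natural: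
  assumes K: "adjunction K" and U: "is_ftor (LAdj K) B A"
    and K': "adjunction K'" and U': "is_ftor (LAdj K') B' A'"
    and P: "is_ftor P A A'" and Q: "is_ftor Q B B'"
    and p: "is_ntr p P P'" and q: "is_ntr q Q Q'"
    and s: "is_ntr s (LAdj K' \<odot> Q) (P \<odot> LAdj K)" "is_ftor (LAdj K' \<odot> Q) B A'"
    and s': "is_ntr s' (LAdj K' \<odot> Q') (P' \<odot> LAdj K)" "is_ftor (LAdj K' \<odot> Q') B A'"
    and sq: "\<And>y. y \<in> Obj B \<Longrightarrow>
      Comp A' (At p (Om (LAdj K) y)) (At s y) = Comp A' (At s' y) (Am (LAdj K') (At q y))"
    and x: "x \<in> Obj A"
  shows "Comp B' (Am (RAdj K') (At p x)) (At (right_mate K K' P Q s) x)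
    = Comp B' (At (right_mate K K' P' Q' s') x) (At q (Om (RAdj K) x))"
proof -
  note R = adjunction_ftors[OF K U] and R' = adjunction_ftors[OF K' U']
  note P' = ntr_ftor[OF p P] and Q' = ntr_ftor[OF q Q]
  have B': "category B'" and A': "category A'"
    using ftor_rules[OF U'] by auto
  note [simp] = ftor_rules(1-9)[OF U] ftor_rules(1-9)[OF U'] ftor_rules(1-9)[OF P] ftor_rules(1-9)[OF Q]
    ftor_rules(1-9)[OF P'] ftor_rules(1-9)[OF Q'] ftor_rules(1-9)[OF R] ftor_rules(1-9)[OF R']
    ntr_rules(1-5)[OF s] ntr_rules(1-5)[OF s'] ntr_rules(1-5)[OF p P] ntr_rules(1-5)[OF q Q] x
    adjunction_rules(5-10)[OF K U] adjunction_rules(5-10)[OF K' U']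
    category_rules(6-8)[OF B'] category_rules(6-8)[OF A']
  note comp = ftor_rules(10)[OF R']
  note a = category_assoc[OF B'] and a' = category_assoc[OF A']
  define r where "r = Om (RAdj K) x"
  define \<epsilon> where "\<epsilon> = At (Counit K) x"
  have [simp]: "r \<in> Obj B" "\<epsilon> \<in> Arr A" "Dom A \<epsilon> = Om (LAdj K) r" "Cod A \<epsilon> = x"
    by (simp_all add: r_def \<epsilon>_def)
  let ?h = "\<lambda>Q. At (Unit K') (Om Q r)" and ?R = "Am (RAdj K')" and ?q = "At q r"
  have nat: "Comp B' (?R (Am (LAdj K') ?q)) (?h Q) = Comp B' (?h Q') ?q"
    using adjunction_rules(13)[OF K' U', of ?q] by simp
  have slide: "Comp A' (At p x) (Comp A' (Am P \<epsilon>) (At s r))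
      = Comp A' (Am P' \<epsilon>) (Comp A' (At s' r) (Am (LAdj K') ?q))"
  proof -
    have "Comp A' (At p x) (Comp A' (Am P \<epsilon>) (At s r)) = Comp A' (Comp A' (At p x) (Am P \<epsilon>)) (At s r)"
      by (simp add: a')
    also have "Comp A' (At p x) (Am P \<epsilon>) = Comp A' (Am P' \<epsilon>) (At p (Om (LAdj K) r))"
      using ntr_rules(6)[OF p P, of \<epsilon>] by simp
    finally show ?thesis
      by (simp add: a' sq)
  qed
  have "Comp B' (?R (At p x)) (At (right_mate K K' P Q s) x)
      = Comp B' (?R (At p x)) (Comp B' (?R (Am P \<epsilon>)) (Comp B' (?R (At s r)) (?h Q)))"
    using At_right_mate[OF K U K' U' P Q _ x, of s] by (simp add: r_def \<epsilon>_def)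
  also have "\<dots> = Comp B' (?R (Comp A' (At p x) (Comp A' (Am P \<epsilon>) (At s r)))) (?h Q)"
    by (simp add: a comp)
  also have "\<dots> = Comp B' (?R (Am P' \<epsilon>)) (Comp B' (?R (At s' r)) (Comp B' (?R (Am (LAdj K') ?q)) (?h Q)))"
    unfolding slide by (simp add: a comp)
  also have "\<dots> = Comp B' (Comp B' (?R (Am P' \<epsilon>)) (Comp B' (?R (At s' r)) (?h Q'))) ?q"
    unfolding nat by (simp add: a)
  also have "Comp B' (?R (Am P' \<epsilon>)) (Comp B' (?R (At s' r)) (?h Q')) = At (right_mate K K' P' Q' s') x"
    using At_right_mate[OF K U K' U' P' Q' _ x, of s'] by (simp add: r_def \<epsilon>_def)
  finally show ?thesis
    by (simp add: r_def)
qed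

text \<open>The right mate is the adjunct of \<open>P \<epsilon> \<circ> s\<close>, so pasting it with the counit of the second
  adjunction recovers that transformation.\<close>

lemma right_mate_counit:
  assumes K: "adjunction K" and U: "is_ftor (LAdj K) B A"
    and K': "adjunction K'" and U': "is_ftor (LAdj K') B' A'"
    and P: "is_ftor P A A'" and Q: "is_ftor Q B B'"
    and s: "is_ntr s (LAdj K' \<odot> Q) (P \<odot> LAdj K)" "is_ftor (LAdj K' \<odot> Q) B A'"
    and x: "x \<in> Obj A"
  shows "Comp A' (At (Counit K') (Om P x)) (Am (LAdj K') (At (right_mate K K' P Q s) x))
    = Comp A' (Am P (At (Counit K) x)) (At s (Om (RAdj K) x))"
proof -
  note R = adjunction_ftors[OF K U] and R' = adjunction_ftors[OF K' U']
  have B': "category B'" and A': "category A'"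
    using ftor_rules[OF U'] by auto
  define r where "r = Om (RAdj K) x"
  define \<epsilon> where "\<epsilon> = At (Counit K) x"
  note [simp] = ftor_rules(1-9)[OF U] ftor_rules(1-9)[OF U'] ftor_rules(1-9)[OF P] ftor_rules(1-9)[OF Q]
    ftor_rules(1-9)[OF R] ftor_rules(1-9)[OF R'] ntr_rules(1-5)[OF s] x
    adjunction_rules(5-10)[OF K U] adjunction_rules(5-10)[OF K' U']
    category_rules(6-10)[OF B'] category_rules(6-10)[OF A']
  have [simp]: "r \<in> Obj B" "\<epsilon> \<in> Arr A" "Dom A \<epsilon> = Om (LAdj K) r" "Cod A \<epsilon> = x"
    by (simp_all add: r_def \<epsilon>_def)
  let ?m = "Comp A' (Am P \<epsilon>) (At s r)" and ?h = "At (Unit K') (Om Q r)"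
  have m: "At (right_mate K K' P Q s) x = Comp B' (Am (RAdj K') ?m) ?h"
    using At_right_mate[OF K U K' U' P Q _ x, of s]
    by (simp add: r_def[symmetric] \<epsilon>_def[symmetric] category_assoc[OF B'] ftor_rules(10)[OF R'])
  have "Comp A' (At (Counit K') (Om P x)) (Am (LAdj K') (At (right_mate K K' P Q s) x))
      = Comp A' (Comp A' (At (Counit K') (Om P x)) (Am (LAdj K') (Am (RAdj K') ?m))) (Am (LAdj K') ?h)"
    unfolding m by (simp add: ftor_rules(10)[OF U'] category_assoc[OF A'])
  also have "Comp A' (At (Counit K') (Om P x)) (Am (LAdj K') (Am (RAdj K') ?m))
      = Comp A' ?m (At (Counit K') (Om (LAdj K') (Om Q r)))"
    using adjunction_rules(14)[OF K' U', of ?m] by simp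
  also have "Comp A' (Comp A' ?m (At (Counit K') (Om (LAdj K') (Om Q r)))) (Am (LAdj K') ?h)
      = Comp A' ?m (Comp A' (At (Counit K') (Om (LAdj K') (Om Q r))) (Am (LAdj K') ?h))"
    by (rule category_assoc[OF A']) simp_all
  also have "\<dots> = ?m"
    using adjunction_rules(11)[OF K' U', of "Om Q r"] by simp
  finally show ?thesis
    by (simp add: r_def \<epsilon>_def)
qed


section \<open>Small categories\<close>

text \<open>An infinite small set contains finite sets of every cardinality.\<close>

lemma finite_small:
  assumes "smallness S" and "finite Y"
  shows "S Y"
proof -
  obtain X where X: "S X" "infinite X"
    using assms(1) unfolding smallness_def by blast
  obtain Z where Z: "Z \<subseteq> X" "card Z = card Y" "finite Z"
    using infinite_arbitrarily_large[OF X(2), of "card Y"] by blast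
  then obtain f where "f ` Z = Y"
    using finite_same_card_bij[of Z Y] assms(2) unfolding bij_betw_def by auto
  moreover have "S Z"
    using assms(1) X(1) Z(1) unfolding smallness_def by blast
  ultimately show ?thesis
    using assms(1) unfolding smallness_def by blast
qed

lemma mk_cat_simps [simp]:
  "Obj (mk_cat Ob Ar d c i m) = Ob" "Arr (mk_cat Ob Ar d c i m) = Ar"
  "f \<in> Ar \<Longrightarrow> Dom (mk_cat Ob Ar d c i m) f = d f"
  "f \<in> Ar \<Longrightarrow> Cod (mk_cat Ob Ar d c i m) f = c f"
  "a \<in> Ob \<Longrightarrow> Idn (mk_cat Ob Ar d c i m) a = i a"
  "f \<in> Ar \<Longrightarrow> g \<in> Ar \<Longrightarrow> c f = d g \<Longrightarrow> Comp (mk_cat Ob Ar d c i m) g f = m g f"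
  by (simp_all add: mk_cat_def)

lemma category_mk_cat:
  assumes "\<And>f. f \<in> Ar \<Longrightarrow> d f \<in> Ob \<and> c f \<in> Ob"
    and "\<And>a. a \<in> Ob \<Longrightarrow> i a \<in> Ar \<and> d (i a) = a \<and> c (i a) = a"
    and "\<And>f g. \<lbrakk>f \<in> Ar; g \<in> Ar; c f = d g\<rbrakk> \<Longrightarrow> m g f \<in> Ar \<and> d (m g f) = d f \<and> c (m g f) = c g"
    and "\<And>f. f \<in> Ar \<Longrightarrow> m f (i (d f)) = f \<and> m (i (c f)) f = f"
    and "\<And>f g h. \<lbrakk>f \<in> Ar; g \<in> Ar; h \<in> Ar; c f = d g; c g = d h\<rbrakk> \<Longrightarrow> m h (m g f) = m (m h g) f"
  shows "category (mk_cat Ob Ar d c i m)"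
  unfolding category_def in_hom_def mk_cat_def
  by (intro conjI allI ballI impI) (auto simp: assms(1-4) intro!: assms(5))

lemma mk_cat_cong:
  assumes "Ob = Ob'" and "Ar = Ar'"
    and "\<And>f. f \<in> Ar \<Longrightarrow> d f = d' f" and "\<And>f. f \<in> Ar \<Longrightarrow> c f = c' f" and "\<And>a. a \<in> Ob \<Longrightarrow> i a = i' a"
    and "\<And>f g. \<lbrakk>f \<in> Ar; g \<in> Ar; c f = d g\<rbrakk> \<Longrightarrow> m g f = m' g f"
  shows "mk_cat Ob Ar d c i m = mk_cat Ob' Ar' d' c' i' m'"
  using assms unfolding mk_cat_def by (auto simp: fun_eq_iff restrict_def)

lemma is_ftor_mk_ftor:
  assumes "category A" and "category B"
    and "\<And>x. x \<in> Obj A \<Longrightarrow> o' x \<in> Obj B"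
    and "\<And>f. f \<in> Arr A \<Longrightarrow> m f \<in> Arr B \<and> Dom B (m f) = o' (Dom A f) \<and> Cod B (m f) = o' (Cod A f)"
    and "\<And>x. x \<in> Obj A \<Longrightarrow> m (Idn A x) = Idn B (o' x)"
    and "\<And>f g. \<lbrakk>f \<in> Arr A; g \<in> Arr A; Cod A f = Dom A g\<rbrakk> \<Longrightarrow> m (Comp A g f) = Comp B (m g) (m f)"
  shows "is_ftor (mk_ftor A B o' m) A B"
  using assms category_rules[OF assms(1)]
  unfolding is_ftor_def mk_ftor_def in_hom_def by auto

lemma mk_ftor_simps [simp]:
  "Src (mk_ftor A B o' m) = A" "Tgt (mk_ftor A B o' m) = B"
  "x \<in> Obj A \<Longrightarrow> Om (mk_ftor A B o' m) x = o' x"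
  "f \<in> Arr A \<Longrightarrow> Am (mk_ftor A B o' m) f = m f"
  by (simp_all add: mk_ftor_def)

text \<open>The terminal category with chosen object and arrow; comma categories with a single arrow are
  of this form.\<close>

definition single_cat :: "'u elt \<Rightarrow> 'u elt \<Rightarrow> 'u scat" where
  "single_cat x m = mk_cat {x} {m} (\<lambda>_. x) (\<lambda>_. x) (\<lambda>_. m) (\<lambda>_ _. m)"

lemma category_single: "category (single_cat x m)"
  unfolding single_cat_def by (rule category_mk_cat) auto

lemma one_cat_single: "one_cat = single_cat E0 E0"
  by (simp add: one_cat_def single_cat_def)

lemma one_cat_simps [simp]:
  "Obj one_cat = {E0}" "Arr one_cat = {E0}" "Dom one_cat E0 = E0" "Cod one_cat E0 = E0"
  "Idn one_cat E0 = E0" "Comp one_cat E0 E0 = E0"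
  by (simp_all add: one_cat_def)

lemma small_single: "smallness S \<Longrightarrow> small_cat S (single_cat x m)"
  unfolding small_cat_def using category_single[of x m] by (simp add: finite_small single_cat_def)

lemma small_one: "smallness S \<Longrightarrow> small_cat S one_cat"
  unfolding one_cat_single by (rule small_single)

lemma small_pt:
  assumes "smallness S" and "small_cat S A" and "a \<in> Obj A"
  shows "small_ftor S (pt A a) one_cat A"
proof -
  have A: "category A"
    using assms(2) unfolding small_cat_def by auto
  have "is_ftor (pt A a) one_cat A"
    unfolding pt_def using assms(3) category_rules[OF A]
    by (intro is_ftor_mk_ftor A) (auto simp: small_one[OF assms(1), unfolded small_cat_def])
  then show ?thesis
    unfolding small_ftor_def using assms small_one by blast
qed

lemma small_bang:
  assumes "smallness S" and "small_cat S A"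
  shows "small_ftor S (bang A) A one_cat"
proof -
  have A: "category A"
    using assms(2) unfolding small_cat_def by auto
  have "is_ftor (bang A) A one_cat"
    unfolding bang_def using category_rules[OF A]
    by (intro is_ftor_mk_ftor A) (auto simp: small_one[OF assms(1), unfolded small_cat_def])
  then show ?thesis
    unfolding small_ftor_def using assms small_one by blast
qed

lemma category_interval: "category interval_cat"
  unfolding interval_cat_def by (rule category_mk_cat) auto

lemma category_prod2:
  assumes "category A" and "category B"
  shows "category (prod2_cat A B)"
  unfolding prod2_cat_def
  by (rule category_mk_cat) (auto simp: category_rules[OF assms(1)] category_rules[OF assms(2)])

lemma category_full_subcat:
  assumes "category A"
  shows "category (full_subcat A X)"
  unfolding full_subcat_def
  by (rule category_mk_cat) (auto simp: category_rules[OF assms])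

lemma is_ftor_full_incl:
  assumes "category A"
  shows "is_ftor (full_incl A X) (full_subcat A X) A"
  unfolding full_incl_def using category_rules[OF assms]
  by (intro is_ftor_mk_ftor category_full_subcat assms) (auto simp: full_subcat_def)

lemma small_square:
  fixes S :: "'u elt set \<Rightarrow> bool"
  assumes "smallness S"
  shows "small_cat S square_cat"
proof -
  have "category (square_cat :: 'u scat)"
    unfolding square_cat_def by (intro category_prod2 category_interval)
  moreover have "finite (Obj (square_cat :: 'u scat))" "finite (Arr (square_cat :: 'u scat))"
    unfolding square_cat_def prod2_cat_def by (auto intro!: finite_image_set2 simp: interval_cat_def)
  ultimately show ?thesis
    unfolding small_cat_def by (simp add: finite_small[OF assms])
qed

lemma small_corner_incl:
  assumes "smallness S"
  shows "small_ftor S corner_incl corner_cat square_cat"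
proof -
  have sq: "small_cat S square_cat"
    by (rule small_square[OF assms])
  have sub: "S Z" if "S Y" "Z \<subseteq> Y" for Y Z
    using that assms unfolding smallness_def by blast
  have "small_cat S corner_cat"
    using sq unfolding small_cat_def corner_cat_def
    by (auto simp: category_full_subcat) (auto simp: full_subcat_def elim: sub)
  then show ?thesis
    using sq unfolding small_ftor_def corner_incl_def corner_cat_def
    by (auto simp: small_cat_def is_ftor_full_incl)
qed

text \<open>The corner is a poset with least element \<open>(0,0)\<close>, so that the only arrow into \<open>(0,0)\<close> is its
  identity. This makes the point \<open>(0,0)\<close> a sieve.\<close>

lemma corner_least:
  shows "Pr E0 E0 \<in> Obj corner_cat"
    and "f \<in> Arr corner_cat \<Longrightarrow> Cod corner_cat f = Pr E0 E0 \<Longrightarrow> f = Idn corner_cat (Pr E0 E0)"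
  unfolding corner_cat_def square_cat_def full_subcat_def prod2_cat_def interval_cat_def
  by auto


section \<open>Right Kan extension along a sieve consisting of one point\<close>

lemma pt_simps [simp]:
  "Src (pt C i) = one_cat" "Tgt (pt C i) = C" "Om (pt C i) E0 = i" "Am (pt C i) E0 = Idn C i"
  by (simp_all add: pt_def)

lemma in_hom_one_cat [simp]: "in_hom one_cat h a b \<longleftrightarrow> h = E0 \<and> a = E0 \<and> b = E0"
  unfolding in_hom_def by auto

lemma comma_pt_self:
  assumes C: "category C" and i: "i \<in> Obj C"
    and least: "\<And>f. f \<in> Arr C \<Longrightarrow> Cod C f = i \<Longrightarrow> f = Idn C i"
  shows "comma_cat (pt C i) (pt C i) =
    (let x = Pr (Pr E0 E0) (Idn C i) in single_cat x (Pr (Pr x x) (Pr E0 E0)))"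
proof -
  note [simp] = category_rules(1-10)[OF C] i
  have [simp]: "in_hom C f i i \<longleftrightarrow> f = Idn C i" for f
    using least[of f] unfolding in_hom_def by auto
  show ?thesis
    unfolding comma_cat_def single_cat_def Let_def by (rule mk_cat_cong) auto
qed

lemma comma_pt_empty:
  assumes "\<And>f. \<not> in_hom C f b i"
  shows "comma_cat (pt C b) (pt C i) = coprod_cat {} A"
  unfolding comma_cat_def coprod_cat_def by (rule mk_cat_cong) (auto simp: assms)

lemma prederivator_rules:
  assumes "prederivator S D"
  shows "small_cat S A \<Longrightarrow> category (DC D A)"
    and "small_ftor S u A B \<Longrightarrow> is_ftor (DF D u) (DC D B) (DC D A)"
    and "small_cat S A \<Longrightarrow> DF D (id_ftor A) = id_ftor (DC D A)"
    and "small_ftor S u A B \<Longrightarrow> small_ftor S v B C \<Longrightarrow> DF D (v \<odot> u) = DF D u \<odot> DF D v"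
    and "small_ftor S u A B \<Longrightarrow> DN D (id_ntr u) = id_ntr (DF D u)"
  using assms unfolding prederivator_def by metis+

lemma derivator_imp_prederivator: "derivator S D \<Longrightarrow> prederivator S D"
  unfolding derivator_def by auto

lemma single_cat_iso:
  assumes "small_cat S (single_cat x m)"
  shows "bang (single_cat x m) \<odot> pt (single_cat x m) x = id_ftor one_cat"
    and "pt (single_cat x m) x \<odot> bang (single_cat x m) = id_ftor (single_cat x m)"
  unfolding bang_def pt_def single_cat_def comp_ftor_def mk_ftor_def id_ftor_def
  by (auto simp: fun_eq_iff restrict_def one_cat_def)

text \<open>The slice under \<open>i\<close> is a single point, so its limit functor may be taken to be evaluation at
  that point. The base change map of (Der4) at \<open>i\<close> is then the counit itself.\<close>

lemma point_counit_iso: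
  assumes S: "smallness S" and D: "derivator S D" and C: "small_cat S C" and i: "i \<in> Obj C"
    and least: "\<And>f. f \<in> Arr C \<Longrightarrow> Cod C f = i \<Longrightarrow> f = Idn C i"
    and K: "right_kan D (pt C i) K" and x: "x \<in> Obj (DC D one_cat)"
  shows "iso_arr (DC D one_cat) (At (Counit K) x)"
proof -
  have catC: "category C"
    using C unfolding small_cat_def by auto
  define o' where "o' = Pr (Pr E0 E0) (Idn C i)"
  define W where "W = single_cat o' (Pr (Pr o' o') (Pr E0 E0))"
  have W: "comma_cat (pt C i) (pt C i) = W"
    using comma_pt_self[OF catC i least] unfolding W_def o'_def Let_def .
  have fst: "comma_fst (pt C i) (pt C i) = bang W" and snd: "comma_snd (pt C i) (pt C i) = bang W"
    unfolding comma_fst_def comma_snd_def bang_def W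
    by (auto simp: mk_ftor_def W_def single_cat_def o'_def)
  have cell: "comma_cell (pt C i) (pt C i) = id_ntr (pt C i \<odot> bang W)"
    unfolding comma_cell_def fst snd id_ntr_def
    by (auto simp: mk_ntr_def W_def single_cat_def o'_def bang_def)
  have smW: "small_cat S W"
    unfolding W_def by (rule small_single[OF S])
  have o': "o' \<in> Obj W"
    by (simp add: W_def single_cat_def)
  note P = prederivator_rules[OF derivator_imp_prederivator[OF D]]
  note bW = small_bang[OF S smW] and pW = small_pt[OF S smW o'] and pC = small_pt[OF S C i]
  have cD1: "category (DC D one_cat)" and cDW: "category (DC D W)"
    using P(1) small_one[OF S] smW by auto
  note FB = P(2)[OF bW] and FP = P(2)[OF pW] and FC = P(2)[OF pC]
  have BP: "DF D (pt W o') \<odot> DF D (bang W) = id_ftor (DC D one_cat)"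
    using P(4)[OF pW bW] P(3)[OF small_one[OF S]] single_cat_iso(1) smW unfolding W_def by metis
  have PB: "DF D (bang W) \<odot> DF D (pt W o') = id_ftor (DC D W)"
    using P(4)[OF bW pW] P(3)[OF smW] single_cat_iso(2) smW unfolding W_def by metis
  note [simp] = ftor_rules(3-9)[OF FB] ftor_rules(3-9)[OF FP] ftor_rules(3-9)[OF FC]
    category_rules(1-10)[OF cD1] category_rules(1-10)[OF cDW]
  define K' where "K' = \<lparr>LAdj = DF D (bang W), RAdj = DF D (pt W o'),
    Unit = id_ntr (id_ftor (DC D one_cat)), Counit = id_ntr (id_ftor (DC D W))\<rparr>"
  have "adjunction K'"
    unfolding K'_def by (rule inverse_adjunction[OF FB FP BP PB])
  then have K': "right_kan D (bang W) K'" "adjunction K'" "LAdj K' = DF D (bang W)"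
    unfolding right_kan_def by (auto simp: K'_def)
  let ?m = "right_mate K K' (DF D (bang W)) (DF D (pt C i)) (DN D (id_ntr (pt C i \<odot> bang W)))"
  have adjK: "adjunction K" and LK [simp]: "LAdj K = DF D (pt C i)"
    using K unfolding right_kan_def by auto
  have U: "is_ftor (LAdj K) (DC D C) (DC D one_cat)"
    using FC by simp
  have U': "is_ftor (LAdj K') (DC D one_cat) (DC D W)"
    using FB K'(3) by simp
  have "is_nat_iso ?m (DF D (pt C i) \<odot> RAdj K) (RAdj K' \<odot> DF D (bang W))"
    using D pC K K'(1) i unfolding derivator_def der4_def
    by (metis W snd cell pt_simps(2))
  then have iso: "iso_arr (DC D one_cat) (At ?m x)"
    using x ftor_rules[OF adjunction_ftors[OF adjK U]] unfolding is_nat_iso_def by simp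
  have iu: "small_ftor S (pt C i \<odot> bang W) W C"
    using is_ftor_comp bW pC unfolding small_ftor_def by blast
  have s: "DN D (id_ntr (pt C i \<odot> bang W)) = id_ntr (DF D (bang W) \<odot> DF D (pt C i))"
    using P(5)[OF iu] P(4)[OF bW pC] by simp
  note [simp] = ftor_rules(3-9)[OF adjunction_ftors[OF adjK U]] adjunction_rules(5-10)[OF adjK U]
  have ev: "Am (DF D (pt W o')) (Am (DF D (bang W)) f) = f" if "f \<in> Arr (DC D one_cat)" for f
    using arg_cong[OF BP, of "\<lambda>F. Am F f"] that by simp
  have ev': "Om (DF D (pt W o')) (Om (DF D (bang W)) y) = y" if "y \<in> Obj (DC D one_cat)" for y
    using arg_cong[OF BP, of "\<lambda>F. Om F y"] that by simp
  \<comment> \<open>evaluation after \<open>\<pi>\<^sup>*\<close> is strictly the identity, so only the counit survives in the mate\<close>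
  have "At ?m x = At (Counit K) x"
    using At_right_mate[OF adjK U K'(2) U' FB FC _ x, of "DN D (id_ntr (pt C i \<odot> bang W))"] x
    by (simp add: s id_ntr_def[of "DF D (bang W) \<odot> DF D (pt C i)"] K'_def ev ev')
  then show ?thesis
    using iso by simp
qed

text \<open>If \<open>b\<close> has no arrow to \<open>i\<close>, the slice under \<open>b\<close> is empty. By (Der1) \<open>D\<close> takes the empty
  category to one equivalent to the terminal category, in which every object is terminal, and right
  adjoints preserve terminal objects.\<close>

lemma kan_terminal_outside:
  fixes S :: "'u elt set \<Rightarrow> bool"
  assumes S: "smallness S" and D: "derivator S D" and C: "small_cat S C" and i: "i \<in> Obj C"
    and b: "b \<in> Obj C" and none: "\<And>f. \<not> in_hom C f b i"
    and K: "right_kan D (pt C i) K" and x: "x \<in> Obj (DC D one_cat)"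
  shows "terminal_object (DC D one_cat) (Om (DF D (pt C b)) (Om (RAdj K) x))"
proof -
  define W :: "'u scat" where "W = coprod_cat {} (\<lambda>_. one_cat)"
  have W: "comma_cat (pt C b) (pt C i) = W"
    unfolding W_def by (rule comma_pt_empty[OF none])
  have W0: "Obj W = {}" "Arr W = {}"
    by (simp_all add: W_def coprod_cat_def)
  have smW: "small_cat S W"
    unfolding small_cat_def W0 by (auto simp: W_def coprod_cat_def finite_small[OF S] intro!: category_mk_cat)
  note P = prederivator_rules[OF derivator_imp_prederivator[OF D]]
  note bW = small_bang[OF S smW] and pb = small_pt[OF S C b] and pC = small_pt[OF S C i]
  have cD1: "category (DC D one_cat)"
    using P(1) small_one[OF S] by auto
  have all_terminal: "terminal_object (DC D W) y" if "y \<in> Obj (DC D W)" for y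
  proof (rule equivalence_trivial_terminal[OF _ _ _ that])
    have "der1 S D"
      using D unfolding derivator_def by auto
    from this[unfolded der1_def, rule_format, of "{}" "\<lambda>_. one_cat"] show "equivalence_ftor
       (mk_ftor (DC D W) (prod_cat {} (\<lambda>_. DC D one_cat))
          (\<lambda>x. \<lambda>i\<in>{}. Om (DF D (coprod_in {} (\<lambda>_. one_cat) i)) x)
          (\<lambda>f. \<lambda>i\<in>{}. Am (DF D (coprod_in {} (\<lambda>_. one_cat) i)) f))
       (DC D W) (prod_cat {} (\<lambda>_. DC D one_cat))"
      unfolding W_def by (simp add: finite_small[OF S])
    show "Obj (prod_cat {} (\<lambda>_. DC D one_cat)) = {\<lambda>_. undefined}"
      "Arr (prod_cat {} (\<lambda>_. DC D one_cat)) = {\<lambda>_. undefined}"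
      by (simp_all add: prod_cat_def)
  qed
  obtain K' where K': "right_kan D (bang W) K'"
    using D bW unfolding derivator_def der3_def by blast
  have U': "is_ftor (LAdj K') (DC D one_cat) (DC D W)" and adjK': "adjunction K'"
    using P(2)[OF bW] K' unfolding right_kan_def by auto
  have U: "is_ftor (LAdj K) (DC D C) (DC D one_cat)" and adjK: "adjunction K"
    using P(2)[OF pC] K unfolding right_kan_def by auto
  let ?q = "comma_snd (pt C b) (pt C i)"
  have "is_ftor ?q W one_cat"
    unfolding comma_snd_def W pt_simps using smW small_one[OF S]
    by (intro is_ftor_mk_ftor) (auto simp: W0 small_cat_def)
  then have q: "is_ftor (DF D ?q) (DC D one_cat) (DC D W)"
    using P(2)[of ?q W one_cat] smW small_one[OF S] unfolding small_ftor_def by blast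
  have "is_nat_iso (right_mate K K' (DF D ?q) (DF D (pt C b)) (DN D (comma_cell (pt C b) (pt C i))))
      (DF D (pt C b) \<odot> RAdj K) (RAdj K' \<odot> DF D ?q)"
    using D b pC K K' unfolding derivator_def der4_def
    by (metis W pt_simps(2))
  then obtain t where t: "is_nat_iso t (DF D (pt C b) \<odot> RAdj K) (RAdj K' \<odot> DF D ?q)"
    by blast
  note R = adjunction_ftors[OF adjK U]
  note c = is_ftor_comp[OF R P(2)[OF pb]]
  note [simp] = ftor_rules(3-9)[OF R] ftor_rules(3-9)[OF P(2)[OF pb]] ftor_rules(3-9)[OF q]
  have n: "is_ntr t (DF D (pt C b) \<odot> RAdj K) (RAdj K' \<odot> DF D ?q)"
    using t unfolding is_nat_iso_def by auto
  have iso: "iso_arr (DC D one_cat) (At t x)"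
    using t x unfolding is_nat_iso_def by simp
  have "terminal_object (DC D one_cat) (Om (RAdj K') (Om (DF D ?q) x))"
    using x by (intro right_adjoint_terminal[OF adjK' U'] all_terminal) simp
  then show ?thesis
    using terminal_iso_closed[OF cD1 _ iso] ntr_rules(4,5)[OF n c x] x by simp
qed

text \<open>By (Der2) it suffices to look at the points \<open>b\<close> of \<open>C\<close>. At \<open>b = i\<close> the canonical map is
  conjugate, through the invertible counits, to the structure isomorphism of \<open>F\<close>. At any other \<open>b\<close>
  both Kan extensions vanish, and \<open>F\<close> preserves zero objects.\<close>

lemma pointed_right_kan_map_iso:
  assumes S: "smallness S" and D: "pointed_derivator S D" and E: "pointed_derivator S E"
    and F: "pointed_morphism S D E F"
    and C: "small_cat S C" and i: "i \<in> Obj C"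
    and least: "\<And>f. f \<in> Arr C \<Longrightarrow> Cod C f = i \<Longrightarrow> f = Idn C i"
    and KD: "right_kan D (pt C i) KD" and KE: "right_kan E (pt C i) KE"
    and x: "x \<in> Obj (DC D one_cat)"
  shows "iso_arr (DC E C) (At (right_kan_map KD KE F (pt C i)) x)"
proof -
  have dD: "derivator S D" and dE: "derivator S E"
    using D E unfolding pointed_derivator_def by auto
  have mF: "morphism S D E F"
    using F unfolding pointed_morphism_def by auto
  note PD = prederivator_rules[OF derivator_imp_prederivator[OF dD]]
  note PE = prederivator_rules[OF derivator_imp_prederivator[OF dE]]
  have F1: "is_ftor (MF F one_cat) (DC D one_cat) (DC E one_cat)"
    and FC: "is_ftor (MF F C) (DC D C) (DC E C)"
    using mF C small_one[OF S] unfolding morphism_def by blast+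
  have \<gamma>: "is_nat_iso (MC F (pt C b)) (DF E (pt C b) \<odot> MF F C) (MF F one_cat \<odot> DF D (pt C b))"
    if "b \<in> Obj C" for b
    using mF small_pt[OF S C that] unfolding morphism_def by blast
  have cD1: "category (DC D one_cat)" and cE1: "category (DC E one_cat)"
    using PD(1) PE(1) small_one[OF S] by auto
  have adjD: "adjunction KD" "LAdj KD = DF D (pt C i)" and adjE: "adjunction KE" "LAdj KE = DF E (pt C i)"
    using KD KE unfolding right_kan_def by auto
  note uD = PD(2)[OF small_pt[OF S C]] and uE = PE(2)[OF small_pt[OF S C]]
  have U: "is_ftor (LAdj KD) (DC D C) (DC D one_cat)" and U': "is_ftor (LAdj KE) (DC E C) (DC E one_cat)"
    using uD[OF i] uE[OF i] adjD adjE by auto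
  have s: "is_ntr (MC F (pt C i)) (LAdj KE \<odot> MF F C) (MF F one_cat \<odot> LAdj KD)"
    using \<gamma>[OF i] adjD adjE unfolding is_nat_iso_def by simp
  note sc = is_ftor_comp[OF FC U']
  note R = adjunction_ftors[OF adjD(1) U] and R' = adjunction_ftors[OF adjE(1) U']
  define M where "M = At (right_kan_map KD KE F (pt C i)) x"
  have M: "M = At (right_mate KD KE (MF F one_cat) (MF F C) (MC F (pt C i))) x"
    unfolding M_def right_kan_map_def by simp
  note [simp] = right_mate_rules[OF adjD(1) U adjE(1) U' F1 FC s sc x, folded M]
    ftor_rules(3-9)[OF F1] ftor_rules(3-9)[OF FC] ftor_rules(3-9)[OF R] ftor_rules(3-9)[OF R'] x
  note [simp] = ftor_rules(3-9)[OF uD[OF i]] ftor_rules(3-9)[OF uE[OF i]]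
  have at: "iso_arr (DC E one_cat) (Am (DF E (pt C b)) M)" if b: "b \<in> Obj C" for b
  proof -
    note [simp] = ftor_rules(3-9)[OF uD[OF b]] ftor_rules(3-9)[OF uE[OF b]]
    have nb: "is_ntr (MC F (pt C b)) (DF E (pt C b) \<odot> MF F C) (MF F one_cat \<odot> DF D (pt C b))"
      using \<gamma>[OF b] unfolding is_nat_iso_def by auto
    have g: "iso_arr (DC E one_cat) (At (MC F (pt C b)) y)" if "y \<in> Obj (DC D C)" for y
      using \<gamma>[OF b] that unfolding is_nat_iso_def by simp
    note nr = ntr_rules(3-5)[OF nb is_ftor_comp[OF FC uE[OF b]]]
    show ?thesis
    proof (cases "b = i")
      case True
      have eD: "iso_arr (DC D one_cat) (At (Counit KD) x)"
        by (rule point_counit_iso[OF S dD C i least KD x])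
      have eE: "iso_arr (DC E one_cat) (At (Counit KE) (Om (MF F one_cat) x))"
        by (rule point_counit_iso[OF S dE C i least KE]) simp_all
      have "iso_arr (DC E one_cat)
          (Comp (DC E one_cat) (Am (MF F one_cat) (At (Counit KD) x)) (At (MC F (pt C i)) (Om (RAdj KD) x)))"
        using nr[of "Om (RAdj KD) x"] adjunction_rules(8-10)[OF adjD(1) U x] True adjD(2)
        by (intro iso_arr_Comp[OF cE1 g[unfolded True] ftor_iso_arr[OF F1 eD]]) simp_all
      then have "iso_arr (DC E one_cat)
          (Comp (DC E one_cat) (At (Counit KE) (Om (MF F one_cat) x)) (Am (LAdj KE) M))"
        using right_mate_counit[OF adjD(1) U adjE(1) U' F1 FC s sc x, folded M] by simp
      then have "iso_arr (DC E one_cat) (Am (LAdj KE) M)"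
        using adjunction_rules(8-10)[OF adjE(1) U', of "Om (MF F one_cat) x"] True adjE(2)
        by - (rule iso_arr_cancel_left[OF cE1 _ eE], simp_all)
      then show ?thesis
        using True adjE(2) by simp
    next
      case False
      have none: "\<not> in_hom C f b i" for f
      proof
        assume f: "in_hom C f b i"
        then have "f = Idn C i"
          using least unfolding in_hom_def by auto
        then show False
          using f False C i category_rules(4)[of C i] unfolding in_hom_def small_cat_def by auto
      qed
      let ?y = "Om (RAdj KD) x"
      obtain z where z: "zero_object (DC D one_cat) z"
        using D unfolding pointed_derivator_def by blast
      then have z': "z \<in> Obj (DC D one_cat)"
        unfolding zero_object_def by auto
      have ty: "terminal_object (DC D one_cat) (Om (DF D (pt C b)) ?y)"
        by (rule kan_terminal_outside[OF S dD C i b none KD x])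
      obtain k where k [simp]: "k \<in> Arr (DC D one_cat)" "Dom (DC D one_cat) k = Om (DF D (pt C b)) ?y"
        "Cod (DC D one_cat) k = z"
        by (rule terminal_obtain[OF zero_imp_terminal[OF z], of "Om (DF D (pt C b)) ?y"]) auto
      have Fk: "iso_arr (DC E one_cat) (Am (MF F one_cat) k)"
        by (rule ftor_iso_arr[OF F1 terminal_iso_arr[OF cD1 ty zero_imp_terminal[OF z] k]])
      have Fz: "terminal_object (DC E one_cat) (Om (MF F one_cat) z)"
        using F z unfolding pointed_morphism_def by (auto intro: zero_imp_terminal)
      have "terminal_object (DC E one_cat) (Dom (DC E one_cat) (Am (MF F one_cat) k))"
        by (rule terminal_iso_closed[OF cE1 Fz Fk]) simp
      then have "terminal_object (DC E one_cat) (Om (MF F one_cat) (Om (DF D (pt C b)) ?y))"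
        by simp
      then have "terminal_object (DC E one_cat) (Dom (DC E one_cat) (At (MC F (pt C b)) ?y))"
        by (rule terminal_iso_closed[OF cE1 _ g]) (simp_all add: nr)
      then have "terminal_object (DC E one_cat) (Om (DF E (pt C b)) (Om (MF F C) ?y))"
        by (simp add: nr)
      moreover have "terminal_object (DC E one_cat)
          (Om (DF E (pt C b)) (Om (RAdj KE) (Om (MF F one_cat) x)))"
        by (rule kan_terminal_outside[OF S dE C i b none KE]) simp
      ultimately show ?thesis
        by (rule terminal_iso_arr[OF cE1]) simp_all
    qed
  qed
  have "der2 S E"
    using dE unfolding derivator_def by auto
  then show ?thesis
    using C at unfolding der2_def M_def[symmetric] by simp
qed


section \<open>Naturality of the canonical maps\<close>

lemma morphism_rules:
  assumes "morphism S D E F" and "small_ftor S u A B"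
  shows "is_ftor (MF F A) (DC D A) (DC E A)" and "is_ftor (MF F B) (DC D B) (DC E B)"
    and "is_nat_iso (MC F u) (DF E u \<odot> MF F B) (MF F A \<odot> DF D u)"
    and "is_ntr (MC F u) (DF E u \<odot> MF F B) (MF F A \<odot> DF D u)"
  using assms unfolding morphism_def small_ftor_def is_nat_iso_def by auto

lemma modification_At:
  assumes D: "prederivator S D" and E: "prederivator S E"
    and F: "morphism S D E F" and G: "morphism S D E G"
    and \<alpha>: "modification S D E F G \<alpha>" and u: "small_ftor S u A B" and y: "y \<in> Obj (DC D B)"
  shows "Comp (DC E A) (At (\<alpha> A) (Om (DF D u) y)) (At (MC F u) y)
    = Comp (DC E A) (At (MC G u) y) (Am (DF E u) (At (\<alpha> B) y))"
proof -
  note f = morphism_rules[OF F u] and g = morphism_rules[OF G u]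
  have "is_ntr (\<alpha> B) (MF F B) (MF G B)"
    and eq: "MC G u \<cdot> (DF E u \<triangleright> \<alpha> B) = (\<alpha> A \<triangleleft> DF D u) \<cdot> MC F u"
    using \<alpha> u unfolding modification_def small_ftor_def by blast+
  note [simp] = ntr_rules(1-2)[OF this(1) f(2)] ftor_rules(3-9)[OF f(1)] ftor_rules(3-9)[OF f(2)]
    ftor_rules(3-9)[OF prederivator_rules(2)[OF D u]] ftor_rules(3-9)[OF prederivator_rules(2)[OF E u]]
    ntr_rules(1-2)[OF f(4) is_ftor_comp[OF f(2) prederivator_rules(2)[OF E u]]]
  show ?thesis
    using arg_cong[OF eq, of "\<lambda>t. At t y"] y by simp
qed

lemma left_kan_map_rules:
  assumes D: "prederivator S D" and E: "prederivator S E" and F: "morphism S D E F"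
    and u: "small_ftor S u A B" and KD: "left_kan D u KD" and KE: "left_kan E u KE"
    and x: "x \<in> Obj (DC D A)"
  shows "At (left_kan_map KD KE F u) x \<in> Arr (DC E B)"
    and "Dom (DC E B) (At (left_kan_map KD KE F u) x) = Om (LAdj KE) (Om (MF F A) x)"
    and "Cod (DC E B) (At (left_kan_map KD KE F u) x) = Om (MF F B) (Om (LAdj KD) x)"
proof -
  note f = morphism_rules[OF F u]
  note uD = prederivator_rules(2)[OF D u] and uE = prederivator_rules(2)[OF E u]
  have K: "adjunction KD" "RAdj KD = DF D u" "adjunction KE" "RAdj KE = DF E u"
    using KD KE unfolding left_kan_def by auto
  have L: "is_ftor (LAdj KD) (DC D A) (DC D B)" "is_ftor (LAdj KE) (DC E A) (DC E B)"
    using adjunction_ftors' uD uE K by metis+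
  have st: "Src u = A" "Tgt u = B"
    using u unfolding small_ftor_def is_ftor_def by auto
  note s = is_ntr_inv[OF f(3) is_ftor_comp[OF f(2) uE], folded K(2,4)]
    is_ftor_comp[OF uD f(1), folded K(2)]
  show "At (left_kan_map KD KE F u) x \<in> Arr (DC E B)"
    "Dom (DC E B) (At (left_kan_map KD KE F u) x) = Om (LAdj KE) (Om (MF F A) x)"
    "Cod (DC E B) (At (left_kan_map KD KE F u) x) = Om (MF F B) (Om (LAdj KD) x)"
    using left_mate_rules[OF K(1) L(1) K(3) L(2) f(1,2) s x] unfolding left_kan_map_def st by auto
qed

lemma right_kan_map_rules:
  assumes D: "prederivator S D" and E: "prederivator S E" and F: "morphism S D E F"
    and u: "small_ftor S u A B" and KD: "right_kan D u KD" and KE: "right_kan E u KE"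
    and x: "x \<in> Obj (DC D A)"
  shows "At (right_kan_map KD KE F u) x \<in> Arr (DC E B)"
    and "Dom (DC E B) (At (right_kan_map KD KE F u) x) = Om (MF F B) (Om (RAdj KD) x)"
    and "Cod (DC E B) (At (right_kan_map KD KE F u) x) = Om (RAdj KE) (Om (MF F A) x)"
proof -
  note f = morphism_rules[OF F u]
  note uD = prederivator_rules(2)[OF D u] and uE = prederivator_rules(2)[OF E u]
  have K: "adjunction KD" "LAdj KD = DF D u" "adjunction KE" "LAdj KE = DF E u"
    using KD KE unfolding right_kan_def by auto
  have st: "Src u = A" "Tgt u = B"
    using u unfolding small_ftor_def is_ftor_def by auto
  show "At (right_kan_map KD KE F u) x \<in> Arr (DC E B)"
    "Dom (DC E B) (At (right_kan_map KD KE F u) x) = Om (MF F B) (Om (RAdj KD) x)"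
    "Cod (DC E B) (At (right_kan_map KD KE F u) x) = Om (RAdj KE) (Om (MF F A) x)"
    using right_mate_rules[OF K(1) uD[folded K(2)] K(3) uE[folded K(4)] f(1,2)
        f(4)[folded K(2,4)] is_ftor_comp[OF f(2) uE, folded K(4)] x]
    unfolding right_kan_map_def st by auto
qed

lemma right_kan_map_ends:
  assumes D: "prederivator S D" and E: "prederivator S E" and F: "morphism S D E F"
    and u: "small_ftor S u A B" and KD: "right_kan D u KD" and KE: "right_kan E u KE"
  shows "NSrc (right_kan_map KD KE F u) = MF F B \<odot> RAdj KD"
    and "NTgt (right_kan_map KD KE F u) = RAdj KE \<odot> MF F A"
proof -
  note f = morphism_rules[OF F u]
  note uD = prederivator_rules(2)[OF D u] and uE = prederivator_rules(2)[OF E u]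
  have K: "adjunction KD" "LAdj KD = DF D u" "adjunction KE" "LAdj KE = DF E u"
    using KD KE unfolding right_kan_def by auto
  have st: "Src u = A" "Tgt u = B"
    using u unfolding small_ftor_def is_ftor_def by auto
  note R = adjunction_ftors[OF K(1) uD[folded K(2)]] and R' = adjunction_ftors[OF K(3) uE[folded K(4)]]
  show "NSrc (right_kan_map KD KE F u) = MF F B \<odot> RAdj KD"
    "NTgt (right_kan_map KD KE F u) = RAdj KE \<odot> MF F A"
    unfolding right_kan_map_def right_mate_def st
    by (simp_all add: adjunction_rules(1-4)[OF K(1) uD[folded K(2)]] adjunction_rules(1-4)[OF K(3) uE[folded K(4)]]
      comp_ftor_id(2)[OF is_ftor_comp[OF R f(2)]] comp_ftor_id(1)[OF is_ftor_comp[OF f(1) R']])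
qed

text \<open>The square required by naturality of left mates involves the inverses of the structure
  isomorphisms, so it is the defining square of a modification turned around.\<close>

lemma left_kan_map_natural:
  assumes D: "prederivator S D" and E: "prederivator S E"
    and F: "morphism S D E F" and G: "morphism S D E G"
    and \<alpha>: "modification S D E F G \<alpha>" and u: "small_ftor S u A B"
    and KD: "left_kan D u KD" and KE: "left_kan E u KE" and x: "x \<in> Obj (DC D A)"
  shows "Comp (DC E B) (At (\<alpha> B) (Om (LAdj KD) x)) (At (left_kan_map KD KE F u) x)
    = Comp (DC E B) (At (left_kan_map KD KE G u) x) (Am (LAdj KE) (At (\<alpha> A) x))"
proof -
  note f = morphism_rules[OF F u] and g = morphism_rules[OF G u]
  note uD = prederivator_rules(2)[OF D u] and uE = prederivator_rules(2)[OF E u]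
  have K: "adjunction KD" "RAdj KD = DF D u" "adjunction KE" "RAdj KE = DF E u"
    using KD KE unfolding left_kan_def by auto
  have L: "is_ftor (LAdj KD) (DC D A) (DC D B)" "is_ftor (LAdj KE) (DC E A) (DC E B)"
    using adjunction_ftors' uD uE K by metis+
  have st: "Src u = A" "Tgt u = B"
    using u unfolding small_ftor_def is_ftor_def by auto
  have \<alpha>A: "is_ntr (\<alpha> A) (MF F A) (MF G A)" and \<alpha>B: "is_ntr (\<alpha> B) (MF F B) (MF G B)"
    using \<alpha> u unfolding modification_def small_ftor_def by blast+
  note cf = is_ftor_comp[OF f(2) uE] and cg = is_ftor_comp[OF g(2) uE]
  note s = is_ntr_inv[OF f(3) cf, folded K(2,4)] is_ftor_comp[OF uD f(1), folded K(2)]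
  note s' = is_ntr_inv[OF g(3) cg, folded K(2,4)] is_ftor_comp[OF uD g(1), folded K(2)]
  have EA: "category (DC E A)"
    using ftor_rules[OF f(1)] by auto
  note [simp] = ftor_rules(3-9)[OF f(1)] ftor_rules(3-9)[OF f(2)] ftor_rules(3-9)[OF g(1)]
    ftor_rules(3-9)[OF g(2)] ftor_rules(3-9)[OF uD] ftor_rules(3-9)[OF uE]
    ntr_rules(1-5)[OF f(4) cf] ntr_rules(1-5)[OF g(4) cg]
    ntr_rules(1-5)[OF \<alpha>A f(1)] ntr_rules(1-5)[OF \<alpha>B f(2)]
  have sq: "Comp (DC E A) (Am (RAdj KE) (At (\<alpha> B) y)) (At (inv_ntr (MC F u)) y)
      = Comp (DC E A) (At (inv_ntr (MC G u)) y) (At (\<alpha> A) (Om (RAdj KD) y))"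
    if y: "y \<in> Obj (DC D B)" for y
  proof -
    have "iso_arr (DC E A) (At (MC F u) y)" "iso_arr (DC E A) (At (MC G u) y)"
      using f(3) g(3) y unfolding is_nat_iso_def by auto
    then have "Comp (DC E A) (Am (DF E u) (At (\<alpha> B) y)) (inv_arr (DC E A) (At (MC F u) y))
      = Comp (DC E A) (inv_arr (DC E A) (At (MC G u) y)) (At (\<alpha> A) (Om (DF D u) y))"
      by (rule inv_arr_square[OF EA]) (simp_all add: y modification_At[OF D E F G \<alpha> u])
    then show ?thesis
      using y by (simp add: K)
  qed
  show ?thesis
    using left_mate_natural[OF K(1) L(1) K(3) L(2) f(1,2) \<alpha>A \<alpha>B s s' sq x]
    unfolding left_kan_map_def st .
qed

lemma right_kan_map_natural:
  assumes D: "prederivator S D" and E: "prederivator S E"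
    and F: "morphism S D E F" and G: "morphism S D E G"
    and \<alpha>: "modification S D E F G \<alpha>" and u: "small_ftor S u A B"
    and KD: "right_kan D u KD" and KE: "right_kan E u KE" and x: "x \<in> Obj (DC D A)"
  shows "Comp (DC E B) (Am (RAdj KE) (At (\<alpha> A) x)) (At (right_kan_map KD KE F u) x)
    = Comp (DC E B) (At (right_kan_map KD KE G u) x) (At (\<alpha> B) (Om (RAdj KD) x))"
proof -
  note f = morphism_rules[OF F u] and g = morphism_rules[OF G u]
  note uD = prederivator_rules(2)[OF D u] and uE = prederivator_rules(2)[OF E u]
  have K: "adjunction KD" "LAdj KD = DF D u" "adjunction KE" "LAdj KE = DF E u"
    using KD KE unfolding right_kan_def by auto
  have st: "Src u = A" "Tgt u = B"
    using u unfolding small_ftor_def is_ftor_def by auto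
  have \<alpha>A: "is_ntr (\<alpha> A) (MF F A) (MF G A)" and \<alpha>B: "is_ntr (\<alpha> B) (MF F B) (MF G B)"
    using \<alpha> u unfolding modification_def small_ftor_def by blast+
  note sq = modification_At[OF D E F G \<alpha> u, folded K(2,4)]
  show ?thesis
    using right_mate_natural[OF K(1) uD[folded K(2)] K(3) uE[folded K(4)] f(1,2) \<alpha>A \<alpha>B
        f(4)[folded K(2,4)] is_ftor_comp[OF f(2) uE, folded K(4)]
        g(4)[folded K(2,4)] is_ftor_comp[OF g(2) uE, folded K(4)] sq x]
    unfolding right_kan_map_def st .
qed


section \<open>The suspension square\<close>

theorem proposition8p14:
  fixes S :: "'u elt set \<Rightarrow> bool"
    and D :: "('u, 'o, 'm) prederiv"
    and E :: "('u, 'p, 'n) prederiv"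
    and F G :: "('u, 'o, 'm, 'p, 'n) dmor"
    and \<alpha> :: "'u scat \<Rightarrow> ('o, 'm, 'p, 'n) ntr"
    and LD RD :: "('o, 'm, 'o, 'm) adj"
    and LE RE :: "('p, 'n, 'p, 'n) adj"
  assumes "smallness S"
    and "pointed_derivator S D" and "pointed_derivator S E"
    and "pointed_morphism S D E F" and "pointed_morphism S D E G"
    and "modification S D E F G \<alpha>"
    and "left_kan D corner_incl LD" and "right_kan D corner_pt RD"
    and "left_kan E corner_incl LE" and "right_kan E corner_pt RE"
  shows "(\<alpha> one_cat \<triangleleft> Susp D LD RD) \<cdot> susp_comparison D E LD RD LE RE F
       = susp_comparison D E LD RD LE RE G \<cdot> (Susp E LE RE \<triangleright> \<alpha> one_cat)"
proof -
  note S = assms(1) and \<alpha> = assms(6) and LD = assms(7) and RD = assms(8) and LE = assms(9) and RE = assms(10)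
  have D: "prederivator S D" and E: "prederivator S E"
    using assms(2,3) unfolding pointed_derivator_def derivator_def by auto
  have F: "morphism S D E F" and G: "morphism S D E G"
    using assms(4,5) unfolding pointed_morphism_def by auto
  let ?C = "corner_cat :: 'u scat" and ?Q = "square_cat :: 'u scat"
  have j: "small_ftor S corner_incl ?C ?Q"
    by (rule small_corner_incl[OF S])
  then have smC: "small_cat S ?C" and smQ: "small_cat S ?Q"
    unfolding small_ftor_def by auto
  have i: "small_ftor S corner_pt one_cat ?C"
    by (rule small_pt[OF S smC corner_least(1)])
  have "Pr E1 E1 \<in> Obj ?Q"
    by (auto simp: square_cat_def prod2_cat_def interval_cat_def)
  then have v: "small_ftor S v11 one_cat ?Q"
    by (rule small_pt[OF S smQ])
  let ?D1 = "DC D one_cat" and ?E1 = "DC E one_cat"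
  define jD where "jD = LAdj LD"
  define jE where "jE = LAdj LE"
  define iD where "iD = RAdj RD"
  define iE where "iE = RAdj RE"
  define vD where "vD = DF D v11"
  define vE where "vE = DF E v11"
  note abbr = jD_def jE_def iD_def iE_def vD_def vE_def
  note F1 = morphism_rules(1)[OF F i] and FC = morphism_rules(2)[OF F i] and FQ = morphism_rules(2)[OF F j]
  note G1 = morphism_rules(1)[OF G i] and GC = morphism_rules(2)[OF G i] and GQ = morphism_rules(2)[OF G j]
  have aD: "adjunction LD" "RAdj LD = DF D corner_incl" "adjunction RD" "LAdj RD = DF D corner_pt"
    and aE: "adjunction LE" "RAdj LE = DF E corner_incl" "adjunction RE" "LAdj RE = DF E corner_pt"
    using LD RD LE RE unfolding left_kan_def right_kan_def by auto
  have JD: "is_ftor jD (DC D ?C) (DC D ?Q)" and JE: "is_ftor jE (DC E ?C) (DC E ?Q)"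
    and ID: "is_ftor iD ?D1 (DC D ?C)" and IE: "is_ftor iE ?E1 (DC E ?C)"
    using adjunction_ftors'[OF aD(1)] adjunction_ftors'[OF aE(1)] adjunction_ftors[OF aD(3)]
      adjunction_ftors[OF aE(3)] prederivator_rules(2)[OF D] prederivator_rules(2)[OF E] i j aD aE
    unfolding jD_def jE_def iD_def iE_def by metis+
  have VD: "is_ftor vD (DC D ?Q) ?D1" and VE: "is_ftor vE (DC E ?Q) ?E1"
    using prederivator_rules(2)[OF D v] prederivator_rules(2)[OF E v] unfolding vD_def vE_def by auto
  have \<alpha>1: "is_ntr (\<alpha> one_cat) (MF F one_cat) (MF G one_cat)"
    and \<alpha>C: "is_ntr (\<alpha> ?C) (MF F ?C) (MF G ?C)" and \<alpha>Q: "is_ntr (\<alpha> ?Q) (MF F ?Q) (MF G ?Q)"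
    using \<alpha> i j unfolding modification_def small_ftor_def by blast+
  have E1: "category ?E1" and EC: "category (DC E ?C)" and EQ: "category (DC E ?Q)"
    using ftor_rules[OF JE] ftor_rules[OF VE] by auto
  note vF = morphism_rules(4)[OF F v, folded vD_def vE_def] is_ftor_comp[OF FQ VE]
  note vG = morphism_rules(4)[OF G v, folded vD_def vE_def] is_ftor_comp[OF GQ VE]
  note [simp] = ftor_rules(3-9)[OF F1] ftor_rules(3-9)[OF FC] ftor_rules(3-9)[OF FQ]
    ftor_rules(3-9)[OF G1] ftor_rules(3-9)[OF GC] ftor_rules(3-9)[OF GQ]
    ftor_rules(3-9)[OF JD] ftor_rules(3-9)[OF JE] ftor_rules(3-9)[OF ID] ftor_rules(3-9)[OF IE]
    ftor_rules(3-9)[OF VD] ftor_rules(3-9)[OF VE]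
    ntr_rules(1-5)[OF \<alpha>1 F1] ntr_rules(1-5)[OF \<alpha>C FC] ntr_rules(1-5)[OF \<alpha>Q FQ]
    ntr_rules(1-5)[OF vF] ntr_rules(1-5)[OF vG]
    category_rules(6-8)[OF E1] category_rules(6-8)[OF EC] category_rules(6-8)[OF EQ]
  note a = category_assoc[OF E1] and compV = ftor_rules(10)[OF VE] and compJ = ftor_rules(10)[OF JE]

  define r where "r H = right_kan_map RD RE H corner_pt" for H :: "('u, 'o, 'm, 'p, 'n) dmor"
  define l where "l H = left_kan_map LD LE H corner_incl" for H :: "('u, 'o, 'm, 'p, 'n) dmor"
  note rF = right_kan_map_rules[OF D E F i RD RE, folded abbr r_def]
    and rG = right_kan_map_rules[OF D E G i RD RE, folded abbr r_def]
    and lF = left_kan_map_rules[OF D E F j LD LE, folded abbr l_def]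
    and lG = left_kan_map_rules[OF D E G j LD LE, folded abbr l_def]
  have isoF: "iso_arr (DC E ?C) (At (r F) x)" and isoG: "iso_arr (DC E ?C) (At (r G) x)"
    if "x \<in> Obj ?D1" for x
    using pointed_right_kan_map_iso[OF S assms(2,3) _ smC corner_least RD RE that] assms(4,5)
    unfolding r_def by auto
  note [simp] = rF rG lF lG inv_arr_rules(2-4)[OF EC isoF] inv_arr_rules(2-4)[OF EC isoG]
    right_kan_map_ends[OF D E F i RD RE, folded abbr r_def]
    right_kan_map_ends[OF D E G i RD RE, folded abbr r_def]
  have susp: "susp_comparison D E LD RD LE RE H = (MC H v11 \<triangleleft> (jD \<odot> iD)) \<cdot>
     (vE \<triangleright> (l H \<triangleleft> iD)) \<cdot> ((vE \<odot> jE) \<triangleright> inv_ntr (r H))" for H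
    unfolding susp_comparison_def abbr r_def l_def ..
  show ?thesis
    unfolding susp Susp_def abbr[symmetric]
  proof (rule vcomp_eqI)
    show "NSrc ((MC F v11 \<triangleleft> (jD \<odot> iD)) \<cdot> (vE \<triangleright> (l F \<triangleleft> iD)) \<cdot> ((vE \<odot> jE) \<triangleright> inv_ntr (r F)))
      = NSrc ((vE \<odot> jE \<odot> iE) \<triangleright> \<alpha> one_cat)"
      by (simp add: comp_ftor_assoc[OF F1] comp_ftor_assoc[OF is_ftor_comp[OF F1 IE]]
        comp_ftor_assoc[OF IE])
    show "NTgt (\<alpha> one_cat \<triangleleft> (vD \<odot> jD \<odot> iD))
      = NTgt ((MC G v11 \<triangleleft> (jD \<odot> iD)) \<cdot> (vE \<triangleright> (l G \<triangleleft> iD)) \<cdot> ((vE \<odot> jE) \<triangleright> inv_ntr (r G)))"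
      by (simp add: comp_ftor_assoc[OF is_ftor_comp[OF ID JD]])
  next
    fix x
    assume "x \<in> Obj (Src (NSrc ((MC F v11 \<triangleleft> (jD \<odot> iD)) \<cdot> (vE \<triangleright> (l F \<triangleleft> iD)) \<cdot>
      ((vE \<odot> jE) \<triangleright> inv_ntr (r F)))))"
    then have x [simp]: "x \<in> Obj ?D1"
      by simp
    define X where "X = Om iD x"
    define Y where "Y = Om jD X"
    have [simp]: "X \<in> Obj (DC D ?C)" "Y \<in> Obj (DC D ?Q)"
      by (simp_all add: X_def Y_def)
    let ?o = "Comp ?E1" and ?V = "Am vE" and ?J = "Am jE"
    let ?iF = "inv_arr (DC E ?C) (At (r F) x)" and ?iG = "inv_arr (DC E ?C) (At (r G) x)"
    note [simp] = rF[OF x, folded X_def] rG[OF x, folded X_def] inv_arr_rules(2-4)[OF EC isoF[OF x]]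
    have 1: "?o (At (\<alpha> one_cat) (Om vD Y)) (At (MC F v11) Y) = ?o (At (MC G v11) Y) (?V (At (\<alpha> ?Q) Y))"
      using modification_At[OF D E F G \<alpha> v, folded abbr] by simp
    have 2: "Comp (DC E ?Q) (At (\<alpha> ?Q) Y) (At (l F) X) = Comp (DC E ?Q) (At (l G) X) (?J (At (\<alpha> ?C) X))"
      using left_kan_map_natural[OF D E F G \<alpha> j LD LE, folded abbr l_def] by (simp add: Y_def)
    \<comment> \<open>the right-mate square, turned around by invertibility of both mates\<close>
    have 3: "Comp (DC E ?C) (At (\<alpha> ?C) X) ?iF = Comp (DC E ?C) ?iG (Am iE (At (\<alpha> one_cat) x))"
      using right_kan_map_natural[OF D E F G \<alpha> i RD RE x, folded abbr r_def]
      by (intro inv_arr_square[OF EC isoF[OF x] isoG[OF x]]) (simp_all add: X_def)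
    have "?o (At (\<alpha> one_cat) (Om vD Y)) (?o (At (MC F v11) Y) (?o (?V (At (l F) X)) (?V (?J ?iF))))
        = ?o (?o (At (\<alpha> one_cat) (Om vD Y)) (At (MC F v11) Y)) (?o (?V (At (l F) X)) (?V (?J ?iF)))"
      by (simp add: a Y_def)
    also have "\<dots> = ?o (At (MC G v11) Y)
        (?o (?V (Comp (DC E ?Q) (At (\<alpha> ?Q) Y) (At (l F) X))) (?V (?J ?iF)))"
      unfolding 1 by (simp add: a compV Y_def)
    also have "\<dots> = ?o (At (MC G v11) Y)
        (?o (?V (At (l G) X)) (?V (?J (Comp (DC E ?C) (At (\<alpha> ?C) X) ?iF))))"
      unfolding 2 by (simp add: a compV compJ Y_def)
    also have "\<dots> = ?o (?o (At (MC G v11) Y) (?o (?V (At (l G) X)) (?V (?J ?iG))))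
        (?V (?J (Am iE (At (\<alpha> one_cat) x))))"
      unfolding 3 by (simp add: a compV compJ Y_def)
    finally show "At ((\<alpha> one_cat \<triangleleft> (vD \<odot> jD \<odot> iD)) \<cdot> (MC F v11 \<triangleleft> (jD \<odot> iD)) \<cdot>
        (vE \<triangleright> (l F \<triangleleft> iD)) \<cdot> ((vE \<odot> jE) \<triangleright> inv_ntr (r F))) x
      = At (((MC G v11 \<triangleleft> (jD \<odot> iD)) \<cdot> (vE \<triangleright> (l G \<triangleleft> iD)) \<cdot> ((vE \<odot> jE) \<triangleright> inv_ntr (r G))) \<cdot>
        ((vE \<odot> jE \<odot> iE) \<triangleright> \<alpha> one_cat)) x"
      by (simp add: X_def Y_def)
  qed
qed

end
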